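(* There is an absolute constant $C>0$ such that the following holds for all positive integers $n,k$. Let $h\colon E(K_{2n})\to\mathbb{R}^k$ be such that $\|h(e)\|_1\le 1$ for all $e\in E(K_{2n})$. Then there is a perfect matching $M$ of $K_{2n}$ satisfying $f_h(M)\le C k^2$.
   Context: For a graph $G$ with at least one edge, a function $h\colon E(G)\to\mathbb{R}^k$ and a subgraph $G'$ of $G$, write $e(G)=|E(G)|$, $h(G')=\sum_{e\in E(G')}h(e)$, and $f_h(G')=\left\|h(G')-\frac{e(G')}{e(G)}h(G)\right\|_1$, where $\|\cdot\|_1$ is the $\ell_1$ norm on $\mathbb{R}^k$. Here $G=K_{2n}$, the complete graph on $2n$ vertices. *)

theory Defs
  imports Complex_Main
begin

text \<open>Simple graphs: an edge is the two-element set of its endpoints.\<close>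

record 'a sgraph =
  sverts :: "'a set"
  sedges :: "'a set set"

definition complete_sgraph :: "'a set \<Rightarrow> 'a sgraph" where
  "complete_sgraph V = \<lparr>sverts = V, sedges = {e. e \<subseteq> V \<and> card e = 2}\<rparr>"

definition is_subgraph :: "'a sgraph \<Rightarrow> 'a sgraph \<Rightarrow> bool" where
  "is_subgraph H G \<longleftrightarrow>
     sverts H \<subseteq> sverts G \<and> sedges H \<subseteq> sedges G \<and> (\<forall>e\<in>sedges H. e \<subseteq> sverts H)"

text \<open>A perfect matching is a spanning subgraph, so that \<open>f\<^sub>h\<close> below applies to it.\<close>

definition is_perfect_matching :: "'a sgraph \<Rightarrow> 'a sgraph \<Rightarrow> bool" where
  "is_perfect_matching M G \<longleftrightarrow>
     is_subgraph M G \<and> sverts M = sverts G \<and> (\<forall>v\<in>sverts G. \<exists>!e. e \<in> sedges M \<and> v \<in> e)"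

definition num_edges :: "'a sgraph \<Rightarrow> nat" where
  "num_edges G = card (sedges G)"

text \<open>
  The dimension \<open>k\<close> has to be quantified inside the scope of the constant \<open>C\<close>, so it cannot be
  a type. A vector of \<open>\<real>\<^sup>k\<close> is a function \<open>nat \<Rightarrow> real\<close> of which only the coordinates
  \<open>i < k\<close> are used. A function on the edges is likewise total, and used on edges only.
\<close>

definition l1_norm :: "nat \<Rightarrow> (nat \<Rightarrow> real) \<Rightarrow> real" where
  "l1_norm k x = (\<Sum>i<k. \<bar>x i\<bar>)"

definition graph_sum :: "('a set \<Rightarrow> nat \<Rightarrow> real) \<Rightarrow> 'a sgraph \<Rightarrow> nat \<Rightarrow> real" where
  "graph_sum h G = (\<lambda>i. \<Sum>e\<in>sedges G. h e i)"

text \<open>\<open>f\<^sub>h(G')\<close>, with the ambient graph \<open>G\<close> and the dimension \<open>k\<close> made explicit.\<close>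

definition graph_disc ::
    "nat \<Rightarrow> ('a set \<Rightarrow> nat \<Rightarrow> real) \<Rightarrow> 'a sgraph \<Rightarrow> 'a sgraph \<Rightarrow> real" where
  "graph_disc k h G G' =
     l1_norm k (\<lambda>i. graph_sum h G' i - real (num_edges G') / real (num_edges G) * graph_sum h G i)"

end

theory Submission
  imports Defs "HOL-Combinatorics.Permutations" "HOL-Analysis.L2_Norm"
begin

text \<open>
  Subtracting a vector \<open>a(u) + a(v)\<close> from each \<open>h({u,v})\<close> turns the discrepancy of a perfect matching
  into the norm of its sum, with all row sums zero. Order the vertices at random and cut them into
  blocks of four: in the block \<open>a, b, c, d\<close> the matching may use \<open>ab, cd\<close> or \<open>ac, bd\<close>, so its sum
  is \<open>D + \<Sum> x\<^sub>B w\<^sub>B\<close> with free signs \<open>x\<^sub>B\<close>. In every direction \<open>y\<close> the second moment of \<open>D\<close> is at most a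
  constant times the expectation of \<open>\<Sum> (w\<^sub>B \<bullet> y)\<^sup>2\<close>, and after adding \<open>\<rho> |y|\<^sup>2\<close>, with \<open>\<rho>\<close> of order \<open>k\<close>, this
  random quadratic form is close to its mean. Hence the solution \<open>z\<close> of \<open>\<rho> z + \<Sum> (w\<^sub>B \<bullet> z) w\<^sub>B = D\<close> is
  short, \<open>x\<^sub>B = - w\<^sub>B \<bullet> z\<close> lies in \<open>[-1, 1]\<close>, and the remaining sum is \<open>\<rho> z\<close>. A linear dependence argument
  makes all but \<open>k\<close> of the \<open>x\<^sub>B\<close> equal to \<open>\<plusminus>1\<close>, and rounding the others costs \<open>O(k)\<close>.
\<close>

section \<open>Positive definite forms on finitely many coordinates\<close>

definition dot :: "nat \<Rightarrow> (nat \<Rightarrow> real) \<Rightarrow> (nat \<Rightarrow> real) \<Rightarrow> real" where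
  "dot k x y = (\<Sum>i<k. x i * y i)"

lemma dot_commute: "dot k x y = dot k y x"
  by (simp add: dot_def mult.commute)

lemma dot_add_scaled_left: "dot k (\<lambda>i. x i + c * y i) z = dot k x z + c * dot k y z"
  by (simp add: dot_def algebra_simps sum.distrib sum_distrib_left)

lemma dot_add_right: "dot k z (\<lambda>i. x i + y i) = dot k z x + dot k z y"
  by (simp add: dot_def algebra_simps sum.distrib)

lemma dot_scale_right: "dot k z (\<lambda>i. c * x i) = c * dot k z x"
  by (simp add: dot_def algebra_simps sum_distrib_left)

lemma dot_sum_right: "dot k z (\<lambda>i. \<Sum>j\<in>J. f j i) = (\<Sum>j\<in>J. dot k z (f j))"
proof -
  have "dot k z (\<lambda>i. \<Sum>j\<in>J. f j i) = (\<Sum>i<k. \<Sum>j\<in>J. z i * f j i)"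
    by (simp add: dot_def sum_distrib_left)
  also have "\<dots> = (\<Sum>j\<in>J. dot k z (f j))"
    unfolding dot_def by (rule sum.swap)
  finally show ?thesis .
qed

lemma dot_self_nonneg: "0 \<le> dot k x x"
  by (simp add: dot_def sum_nonneg)

lemma dot_self_eq_0:
  assumes "dot k x x = 0" and "i < k"
  shows "x i = 0"
proof -
  have "(\<Sum>i<k. x i * x i) = 0"
    using assms(1) by (simp add: dot_def)
  then have "\<forall>i\<in>{..<k}. x i * x i = 0"
    by (subst (asm) sum_nonneg_eq_0_iff) auto
  then show ?thesis using assms(2) by simp
qed

lemma dot_cauchy_schwarz: "(dot k x y)\<^sup>2 \<le> dot k x x * dot k y y"
proof -
  have "\<bar>dot k x y\<bar> \<le> (\<Sum>i<k. \<bar>x i\<bar> * \<bar>y i\<bar>)"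
    unfolding dot_def by (rule order_trans[OF sum_abs]) (simp add: abs_mult)
  also have "\<dots> \<le> L2_set x {..<k} * L2_set y {..<k}"
    by (rule L2_set_mult_ineq)
  finally have "\<bar>dot k x y\<bar>\<^sup>2 \<le> (L2_set x {..<k} * L2_set y {..<k})\<^sup>2"
    by (intro power_mono) auto
  then show ?thesis
    by (simp add: L2_set_def dot_def power_mult_distrib sum_nonneg power2_eq_square[symmetric])
qed

lemma dot_self_le_l1_norm: "dot k x x \<le> (l1_norm k x)\<^sup>2"
proof -
  have "L2_set x {..<k} \<le> l1_norm k x"
    unfolding l1_norm_def by (rule L2_set_le_sum_abs)
  then have "(L2_set x {..<k})\<^sup>2 \<le> (l1_norm k x)\<^sup>2"
    by (intro power_mono) (auto simp: L2_set_nonneg)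
  then show ?thesis
    by (simp add: L2_set_def dot_def sum_nonneg power2_eq_square[symmetric])
qed

lemma l1_norm_le_dot_self: "(l1_norm k x)\<^sup>2 \<le> real k * dot k x x"
proof -
  have "(dot k (\<lambda>_. 1) (\<lambda>i. \<bar>x i\<bar>))\<^sup>2
      \<le> dot k (\<lambda>_. 1) (\<lambda>_. 1) * dot k (\<lambda>i. \<bar>x i\<bar>) (\<lambda>i. \<bar>x i\<bar>)"
    by (rule dot_cauchy_schwarz)
  then show ?thesis by (simp add: dot_def l1_norm_def)
qed

lemma l1_norm_add: "l1_norm k (\<lambda>i. x i + y i) \<le> l1_norm k x + l1_norm k y"
  unfolding l1_norm_def sum.distrib[symmetric] by (rule sum_mono) (rule abs_triangle_ineq)

lemma l1_norm_scale: "l1_norm k (\<lambda>i. c * x i) = \<bar>c\<bar> * l1_norm k x"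
  by (simp add: l1_norm_def abs_mult sum_distrib_left)

lemma l1_norm_minus: "l1_norm k (\<lambda>i. - x i) = l1_norm k x"
  by (simp add: l1_norm_def)

lemma l1_norm_diff: "l1_norm k (\<lambda>i. x i - y i) \<le> l1_norm k x + l1_norm k y"
  using l1_norm_add[of k x "\<lambda>i. - y i"] by (simp add: l1_norm_minus)

lemma l1_norm_sum: "l1_norm k (\<lambda>i. \<Sum>j\<in>J. f j i) \<le> (\<Sum>j\<in>J. l1_norm k (f j))"
proof -
  have "l1_norm k (\<lambda>i. \<Sum>j\<in>J. f j i) \<le> (\<Sum>i<k. \<Sum>j\<in>J. \<bar>f j i\<bar>)"
    unfolding l1_norm_def by (rule sum_mono) (rule sum_abs)
  also have "\<dots> = (\<Sum>j\<in>J. l1_norm k (f j))"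
    unfolding l1_norm_def by (rule sum.swap)
  finally show ?thesis .
qed

section \<open>Expansion, Riesz representation and perturbation for a positive form\<close>

locale positive_form =
  fixes k :: nat and b :: "(nat \<Rightarrow> real) \<Rightarrow> (nat \<Rightarrow> real) \<Rightarrow> real"
  assumes add_scaled: "b (\<lambda>i. x i + c * y i) z = b x z + c * b y z"
    and commute: "b x y = b y x"
    and nonneg: "0 \<le> b x x"
    and definite: "\<lbrakk>\<forall>i\<ge>k. x i = 0; b x x = 0\<rbrakk> \<Longrightarrow> x = (\<lambda>_. 0)"
begin

lemma zero: "b (\<lambda>_. 0) z = 0"
  using add_scaled[of "\<lambda>_. 0" 1 "\<lambda>_. 0" z] by simp

lemma scale: "b (\<lambda>i. c * y i) z = c * b y z"
  using add_scaled[of "\<lambda>_. 0" c y z] by (simp add: zero)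

lemma lincomb: "finite J \<Longrightarrow> b (\<lambda>i. \<Sum>j\<in>J. a j * v j i) z = (\<Sum>j\<in>J. a j * b (v j) z)"
proof (induction J rule: finite_induct)
  case empty
  then show ?case by (simp add: zero)
next
  case (insert x F)
  then show ?case
    using add_scaled[of "\<lambda>i. \<Sum>j\<in>F. a j * v j i" "a x" "v x" z] by (simp add: add.commute)
qed

text \<open>A vector may vanish, so that no linear independence has to be tracked.\<close>

lemma gram_schmidt:
  assumes "n \<le> k"
  shows "\<exists>v. (\<forall>j<n. \<forall>i\<ge>n. v j i = 0) \<and>
     (\<forall>y. (\<forall>i\<ge>n. y i = 0) \<longrightarrow> y = (\<lambda>i. \<Sum>j<n. b y (v j) * v j i))"
  using assms
proof (induction n)
  case 0
  then show ?case by auto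
next
  case (Suc n)
  then obtain v where supp: "\<And>j i. j < n \<Longrightarrow> n \<le> i \<Longrightarrow> v j i = 0"
    and expand: "\<And>y. \<forall>i\<ge>n. y i = 0 \<Longrightarrow> y = (\<lambda>i. \<Sum>j<n. b y (v j) * v j i)"
    by (metis Suc_leD)
  define e where "e = (\<lambda>i. if i = n then 1 else 0 :: real)"
  define r where "r = (\<lambda>i. e i + (-1) * (\<Sum>j<n. b e (v j) * v j i))"
  \<comment> \<open>When \<open>b r r = 0\<close>, division by zero makes \<open>v' n\<close> the
    zero vector.\<close>
  define v' where "v' = v(n := (\<lambda>i. (1 / sqrt (b r r)) * r i))"
  have r_supp: "r i = 0" if "i \<ge> Suc n" for i
    using that supp by (auto simp: r_def e_def)
  \<comment> \<open>The expansion hypothesis applied to \<open>v j\<close> itself replaces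
    orthonormality of the \<open>v j\<close>.\<close>
  have orth: "b r (v j) = 0" if "j < n" for j
  proof -
    have "b (v j) e = b (\<lambda>i. \<Sum>l<n. b (v j) (v l) * v l i) e"
      using expand[of "v j"] supp that by metis
    also have "\<dots> = (\<Sum>l<n. b (v j) (v l) * b (v l) e)"
      by (rule lincomb) simp
    finally show ?thesis
      unfolding r_def add_scaled lincomb[OF finite_lessThan]
      by (simp add: commute mult.commute)
  qed
  have "y = (\<lambda>i. \<Sum>j<Suc n. b y (v' j) * v' j i)" if ys: "\<forall>i\<ge>Suc n. y i = 0" for y
  proof -
    define y' where "y' = (\<lambda>i. y i + (- y n) * e i)"
    have y'_supp: "\<forall>i\<ge>n. y' i = 0"
      using ys by (auto simp: y'_def e_def le_Suc_eq Suc_le_eq)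
    have e_eq: "e i = r i + (\<Sum>j<n. b e (v j) * v j i)" for i
      by (simp add: r_def)
    have y_eq: "y i = (\<Sum>j<n. b y (v j) * v j i) + y n * r i" for i
    proof -
      have "y i = y' i + y n * e i" by (simp add: y'_def)
      also have "y' i = (\<Sum>j<n. b y' (v j) * v j i)"
        using expand[OF y'_supp] by metis
      also have "\<dots> = (\<Sum>j<n. b y (v j) * v j i) - y n * (\<Sum>j<n. b e (v j) * v j i)"
        unfolding y'_def add_scaled
        by (simp add: algebra_simps sum.distrib sum_subtractf sum_distrib_left)
      finally show ?thesis using e_eq[of i] by (simp add: algebra_simps)
    qed
    have "b y r = b (\<lambda>i. (\<Sum>j<n. b y (v j) * v j i) + y n * r i) r"
      using y_eq by (metis (no_types, lifting) ext)
    also have "\<dots> = y n * b r r"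
      unfolding add_scaled lincomb[OF finite_lessThan]
      by (simp add: orth commute[of "v _" r])
    finally have byr: "b y r = y n * b r r" .
    have last: "b y (v' n) * v' n i = y n * r i" for i
    proof (cases "b r r = 0")
      case True
      \<comment> \<open>\<open>definite\<close> speaks of vectors vanishing from coordinate
        \<open>k\<close> on; \<open>r\<close> is one of them, as
        \<open>Suc n \<le> k\<close>.\<close>
      then have "r = (\<lambda>_. 0)"
        using definite[of r] r_supp Suc.prems by simp
      then show ?thesis by (simp add: v'_def)
    next
      case False
      have "b y (v' n) = (1 / sqrt (b r r)) * b y r"
        unfolding v'_def fun_upd_same by (subst commute, subst scale, subst commute, rule refl)
      then have "b y (v' n) * v' n i = (1 / sqrt (b r r))\<^sup>2 * (y n * b r r) * r i"
        by (simp add: v'_def byr power2_eq_square)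
      also have "\<dots> = y n * r i"
        using False nonneg[of r] by (simp add: power_divide)
      finally show ?thesis .
    qed
    show ?thesis
    proof
      fix i
      have "(\<Sum>j<n. b y (v' j) * v' j i) = (\<Sum>j<n. b y (v j) * v j i)"
        by (rule sum.cong) (auto simp: v'_def)
      then show "y i = (\<Sum>j<Suc n. b y (v' j) * v' j i)"
        using y_eq[of i] last[of i] by simp
    qed
  qed
  moreover have "\<forall>j<Suc n. \<forall>i\<ge>Suc n. v' j i = 0"
    using supp r_supp by (auto simp: v'_def less_Suc_eq)
  ultimately show ?case by blast
qed

definition basis :: "nat \<Rightarrow> nat \<Rightarrow> real" where
  "basis = (SOME v. (\<forall>j<k. \<forall>i\<ge>k. v j i = 0) \<and>
     (\<forall>y. (\<forall>i\<ge>k. y i = 0) \<longrightarrow> y = (\<lambda>i. \<Sum>j<k. b y (v j) * v j i)))"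

lemma basis_spec:
  "(\<forall>j<k. \<forall>i\<ge>k. basis j i = 0) \<and>
     (\<forall>y. (\<forall>i\<ge>k. y i = 0) \<longrightarrow> y = (\<lambda>i. \<Sum>j<k. b y (basis j) * basis j i))"
  unfolding basis_def by (rule someI_ex[OF gram_schmidt[OF order_refl]])

lemma basis_supp: "j < k \<Longrightarrow> \<forall>i\<ge>k. basis j i = 0"
  using conjunct1[OF basis_spec] by simp

lemma basis_expansion:
  fixes y :: "nat \<Rightarrow> real"
  assumes "\<forall>i\<ge>k. y i = 0"
  shows "y = (\<lambda>i. \<Sum>j<k. b y (basis j) * basis j i)"
  by (rule conjunct2[OF basis_spec, THEN spec, THEN mp, OF assms])

lemma basis_expansion_left:
  assumes "\<forall>i\<ge>k. y i = 0"
  shows "b y z = (\<Sum>j<k. b y (basis j) * b (basis j) z)"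
  using lincomb[OF finite_lessThan, of "\<lambda>j. b y (basis j)" basis k z]
  unfolding basis_expansion[OF assms, symmetric] .

lemma parseval:
  assumes "\<forall>i\<ge>k. y i = 0"
  shows "b y y = (\<Sum>j<k. (b y (basis j))\<^sup>2)"
  using basis_expansion_left[OF assms, of y] by (simp add: power2_eq_square commute)

text \<open>Keeping one term of Parseval shows that \<open>t = b (basis j) (basis j)\<close>
  satisfies \<open>t * t \<le> t\<close>.\<close>

lemma basis_norm_le_1:
  assumes "j < k"
  shows "b (basis j) (basis j) \<le> 1"
proof -
  have "(b (basis j) (basis j))\<^sup>2 \<le> (\<Sum>l<k. (b (basis j) (basis l))\<^sup>2)"
    using assms by (intro member_le_sum) auto
  also have "\<dots> = b (basis j) (basis j)"
    by (rule parseval[OF basis_supp[OF assms], symmetric])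
  finally have "b (basis j) (basis j) * (b (basis j) (basis j) - 1) \<le> 0"
    by (simp add: power2_eq_square algebra_simps)
  then show ?thesis
    using nonneg[of "basis j"] by (auto simp: mult_le_0_iff)
qed

lemma dot_expansion:
  assumes "\<forall>i\<ge>k. y i = 0"
  shows "dot k y w = (\<Sum>j<k. b y (basis j) * dot k (basis j) w)"
proof -
  have "dot k w y = dot k w (\<lambda>i. \<Sum>j<k. b y (basis j) * basis j i)"
    by (rule arg_cong[OF basis_expansion[OF assms]])
  also have "\<dots> = (\<Sum>j<k. b y (basis j) * dot k w (basis j))"
    by (simp add: dot_sum_right dot_scale_right)
  finally show ?thesis by (simp only: dot_commute[of k w])
qed

text \<open>Solves a positive definite linear system without inverting a matrix: the dot products of
  \<open>w\<close> with the basis are the coefficients of the solution.\<close>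

lemma riesz:
  obtains z where "\<forall>i\<ge>k. z i = 0"
    and "\<And>y. \<forall>i\<ge>k. y i = 0 \<Longrightarrow> b z y = dot k y w"
proof
  define z where "z = (\<lambda>i. \<Sum>j<k. dot k (basis j) w * basis j i)"
  show "\<forall>i\<ge>k. z i = 0"
    using basis_supp by (simp add: z_def)
  show "b z y = dot k y w" if "\<forall>i\<ge>k. y i = 0" for y
    unfolding dot_expansion[OF that, of w] unfolding z_def lincomb[OF finite_lessThan]
    by (simp add: commute mult.commute)
qed

text \<open>The sum is \<open>b z z\<close> for the Riesz representative \<open>z\<close> of
  \<open>w\<close>. Cauchy-Schwarz bounds its square by \<open>dot k z z * dot k w w\<close>, and
  \<open>\<rho> * dot k z z \<le> b z z\<close> lets one factor \<open>b z z\<close> cancel.\<close>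

lemma basis_bessel:
  assumes "\<And>x. \<rho> * dot k x x \<le> b x x" and "\<rho> > 0"
  shows "\<rho> * (\<Sum>j<k. (dot k (basis j) w)\<^sup>2) \<le> dot k w w"
proof -
  obtain z where z: "\<forall>i\<ge>k. z i = 0"
    "\<And>y. \<forall>i\<ge>k. y i = 0 \<Longrightarrow> b z y = dot k y w"
    using riesz by blast
  have S: "(\<Sum>j<k. (dot k (basis j) w)\<^sup>2) = b z z"
    using z(2)[OF basis_supp] by (simp add: parseval[OF z(1)])
  have "(b z z)\<^sup>2 \<le> dot k z z * dot k w w"
    using z dot_cauchy_schwarz by simp
  also have "\<rho> * (dot k z z * dot k w w) \<le> b z z * dot k w w"
    using mult_right_mono[OF assms(1)[of z] dot_self_nonneg[of k w]] by (simp add: mult.assoc)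
  finally have "b z z * (\<rho> * b z z) \<le> b z z * dot k w w"
    using assms(2) by (simp add: power2_eq_square mult_left_mono ac_simps)
  then show ?thesis
    unfolding S using nonneg[of z] dot_self_nonneg[of k w]
    by (cases "b z z = 0") (auto simp: mult_le_cancel_left)
qed

text \<open>In the coordinates \<open>a j = b z (basis j)\<close> the form \<open>b\<close> is the
  squared length. The matrix of \<open>b' - b\<close> has Frobenius norm at most 1/2, so two uses of
  Cauchy-Schwarz bound the difference of the forms at \<open>z\<close> by half of
  \<open>b z z\<close>.\<close>

lemma perturbation:
  assumes b': "positive_form k b'"
    and close: "(\<Sum>i<k. \<Sum>j<k. (b' (basis i) (basis j) - b (basis i) (basis j))\<^sup>2) \<le> 1/4"
    and z: "\<forall>i\<ge>k. z i = 0"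
  shows "b z z \<le> 2 * b' z z"
proof -
  interpret b': positive_form k b' by (rule b')
  define a where "a = (\<lambda>j. b z (basis j))"
  define E where "E = (\<lambda>i j. b' (basis i) (basis j) - b (basis i) (basis j))"
  have expand: "B z z = (\<Sum>i<k. a i * (\<Sum>j<k. a j * B (basis i) (basis j)))"
    if "positive_form k B" for B
  proof -
    interpret B: positive_form k B by (rule that)
    have left: "B z y = (\<Sum>j<k. a j * B (basis j) y)" for y
      using B.lincomb[OF finite_lessThan, of a basis k y]
      unfolding a_def basis_expansion[OF z, symmetric] .
    have "B z z = (\<Sum>i<k. a i * B z (basis i))"
      unfolding left[of z] by (simp only: B.commute[of _ z])
    then show ?thesis
      unfolding left by (simp only: B.commute)
  qed
  have aa: "dot k a a = b z z"
    using parseval[OF z] by (simp add: dot_def a_def power2_eq_square)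
  have "b' z z - b z z = dot k a (\<lambda>i. dot k a (E i))"
    unfolding expand[OF b'] expand[OF positive_form_axioms] dot_def E_def
    by (simp add: sum_subtractf right_diff_distrib)
  then have "(b' z z - b z z)\<^sup>2 \<le> dot k a a * dot k (\<lambda>i. dot k a (E i)) (\<lambda>i. dot k a (E i))"
    using dot_cauchy_schwarz by metis
  also have "\<dots> \<le> dot k a a * (\<Sum>i<k. dot k a a * dot k (E i) (E i))"
    using dot_cauchy_schwarz
    by (intro mult_left_mono dot_self_nonneg)
      (auto simp: dot_def[of k "\<lambda>i. dot k a (E i)"] power2_eq_square[symmetric] intro!: sum_mono)
  also have "\<dots> = (dot k a a)\<^sup>2 * (\<Sum>i<k. \<Sum>j<k. (E i j)\<^sup>2)"
    by (simp add: sum_distrib_left power2_eq_square dot_def[of k "E _"] mult.assoc)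
  also have "\<dots> \<le> (dot k a a)\<^sup>2 * (1/4)"
    using close by (intro mult_left_mono) (auto simp: E_def)
  also have "\<dots> = (b z z / 2)\<^sup>2" by (simp add: aa power_divide)
  finally have "\<bar>b' z z - b z z\<bar> \<le> b z z / 2"
    by (rule abs_le_square_iff[THEN iffD2, THEN order_trans]) (simp add: nonneg)
  then show ?thesis by linarith
qed

end

section \<open>Rounding to signs\<close>

text \<open>Gaussian elimination: a pivot \<open>P\<close> with nonzero last coordinate clears that
  coordinate from the other vectors, and the coefficient of \<open>P\<close> is read off from
  theirs.\<close>

lemma linear_dependence:
  fixes w :: "'a \<Rightarrow> nat \<Rightarrow> real"
  assumes "finite S" and "card S > k"
  shows "\<exists>c. (\<exists>B\<in>S. c B \<noteq> 0) \<and> (\<forall>i<k. (\<Sum>B\<in>S. c B * w B i) = 0)"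
  using assms
proof (induction k arbitrary: S w)
  case 0
  then obtain B where "B \<in> S" by fastforce
  then show ?case by (intro exI[of _ "\<lambda>_. 1"]) auto
next
  case (Suc k)
  show ?case
  proof (cases "\<forall>B\<in>S. w B k = 0")
    case True
    obtain c where "\<exists>B\<in>S. c B \<noteq> 0" "\<forall>i<k. (\<Sum>B\<in>S. c B * w B i) = 0"
      using Suc.IH[of S w] Suc.prems by auto
    with True show ?thesis
      by (intro exI[of _ c]) (auto simp: less_Suc_eq)
  next
    case False
    then obtain P where P: "P \<in> S" "w P k \<noteq> 0" by blast
    define S' where "S' = S - {P}"
    have S': "finite S'" "card S' > k" "S = insert P S'" "P \<notin> S'"
      using Suc.prems P by (auto simp: S'_def card_Diff_singleton)
    obtain c where c: "\<exists>B\<in>S'. c B \<noteq> 0"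
      "\<forall>i<k. (\<Sum>B\<in>S'. c B * (w B i - w B k / w P k * w P i)) = 0"
      using Suc.IH[OF S'(1,2), of "\<lambda>B i. w B i - w B k / w P k * w P i"] by auto
    define d where "d = c(P := - (\<Sum>B\<in>S'. c B * w B k) / w P k)"
    have sum_d: "(\<Sum>B\<in>S. d B * w B i) = (\<Sum>B\<in>S'. c B * (w B i - w B k / w P k * w P i))" for i
    proof -
      have "(\<Sum>B\<in>S. d B * w B i) = d P * w P i + (\<Sum>B\<in>S'. c B * w B i)"
        using S' by (simp add: d_def) (rule sum.cong, auto)
      also have "\<dots> = (\<Sum>B\<in>S'. c B * w B i) - (\<Sum>B\<in>S'. c B * w B k) / w P k * w P i"
        by (simp add: d_def)
      also have "\<dots> = (\<Sum>B\<in>S'. c B * (w B i - w B k / w P k * w P i))"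
        by (simp add: algebra_simps sum_subtractf sum_distrib_left sum_divide_distrib)
      finally show ?thesis .
    qed
    have "\<forall>i<Suc k. (\<Sum>B\<in>S. d B * w B i) = 0"
      using c(2) P(2) by (auto simp: sum_d less_Suc_eq)
    moreover have "\<exists>B\<in>S. d B \<noteq> 0"
      using c(1) S' by (auto simp: d_def)
    ultimately show ?thesis by blast
  qed
qed

text \<open>More than \<open>k\<close> fractional coefficients admit a linear dependence. Moving
  along it keeps the sum and stops when a coefficient first reaches a sign; induct on the number of
  fractional coefficients.\<close>

lemma few_fractional:
  fixes w :: "'a \<Rightarrow> nat \<Rightarrow> real"
  assumes "finite S" and "\<forall>B\<in>S. \<bar>x B\<bar> \<le> 1"
  shows "\<exists>x'. (\<forall>B\<in>S. \<bar>x' B\<bar> \<le> 1) \<and> card {B\<in>S. \<bar>x' B\<bar> \<noteq> 1} \<le> k \<and>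
     (\<forall>i<k. (\<Sum>B\<in>S. x' B * w B i) = (\<Sum>B\<in>S. x B * w B i))"
  using assms(2)
proof (induction "card {B\<in>S. \<bar>x B\<bar> \<noteq> 1}" arbitrary: x rule: less_induct)
  case less
  define F where "F = {B\<in>S. \<bar>x B\<bar> \<noteq> 1}"
  have "finite F" using assms(1) by (simp add: F_def)
  show ?case
  proof (cases "card F \<le> k")
    case True
    then show ?thesis using less.prems by (auto simp: F_def)
  next
    case False
    then obtain c where c: "\<exists>B\<in>F. c B \<noteq> 0" "\<forall>i<k. (\<Sum>B\<in>F. c B * w B i) = 0"
      using linear_dependence[OF \<open>finite F\<close>, of k w] by auto
    \<comment> \<open>The times at which \<open>x B + t * c B\<close> reaches
      \<open>sgn (c B)\<close>; the minimum is the first of them.\<close>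
    define T where "T = (\<lambda>B. (1 - sgn (c B) * x B) / \<bar>c B\<bar>) ` {B\<in>F. c B \<noteq> 0}"
    have T: "finite T" "T \<noteq> {}" using \<open>finite F\<close> c(1) by (auto simp: T_def)
    define t where "t = Min T"
    define y where "y = (\<lambda>B. if B \<in> F then x B + t * c B else x B)"
    have xb: "-1 \<le> x B" "x B \<le> 1" if "B \<in> S" for B
      using less.prems that by (auto simp: abs_le_iff)
    have "t \<ge> 0"
      unfolding t_def using T xb
      by (auto simp: T_def F_def sgn_if intro!: divide_nonneg_nonneg)
    have t_le: "t * \<bar>c B\<bar> \<le> 1 - sgn (c B) * x B" if "B \<in> F" "c B \<noteq> 0" for B
    proof -
      have "t \<le> (1 - sgn (c B) * x B) / \<bar>c B\<bar>"
        unfolding t_def using T that by (intro Min_le) (auto simp: T_def)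
      then show ?thesis using that by (simp add: field_simps)
    qed
    have y_le: "\<bar>y B\<bar> \<le> 1" if "B \<in> S" for B
    proof (cases "B \<in> F \<and> c B \<noteq> 0")
      case True
      then have "t * \<bar>c B\<bar> \<le> 1 - sgn (c B) * x B" "t * \<bar>c B\<bar> \<ge> 0"
        using t_le \<open>t \<ge> 0\<close> by auto
      then show ?thesis using xb[OF that] True
        by (cases "c B > 0") (auto simp: y_def abs_le_iff sgn_if)
    next
      case False
      then show ?thesis using xb[OF that] by (auto simp: y_def abs_le_iff)
    qed
    have "t \<in> T" unfolding t_def using T by (rule Min_in)
    then obtain P where P: "P \<in> F" "c P \<noteq> 0" "t = (1 - sgn (c P) * x P) / \<bar>c P\<bar>"
      by (auto simp: T_def)
    have "\<bar>y P\<bar> = 1"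
      using P by (cases "c P > 0") (auto simp: y_def sgn_if)
    then have "{B\<in>S. \<bar>y B\<bar> \<noteq> 1} \<subset> F"
      using P(1) by (auto simp: F_def y_def)
    then have "card {B\<in>S. \<bar>y B\<bar> \<noteq> 1} < card F"
      using \<open>finite F\<close> by (rule psubset_card_mono[rotated])
    then obtain x' where x': "\<forall>B\<in>S. \<bar>x' B\<bar> \<le> 1" "card {B\<in>S. \<bar>x' B\<bar> \<noteq> 1} \<le> k"
      "\<forall>i<k. (\<Sum>B\<in>S. x' B * w B i) = (\<Sum>B\<in>S. y B * w B i)"
      using less.hyps[of y] y_le unfolding F_def by blast
    have "(\<Sum>B\<in>S. y B * w B i) = (\<Sum>B\<in>S. x B * w B i)" if "i < k" for i
    proof -
      have "(\<Sum>B\<in>S. y B * w B i) = (\<Sum>B\<in>S. x B * w B i + (if B \<in> F then t * (c B * w B i) else 0))"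
        by (rule sum.cong) (auto simp: y_def algebra_simps)
      also have "\<dots> = (\<Sum>B\<in>S. x B * w B i) + (\<Sum>B\<in>F. t * (c B * w B i))"
        using assms(1) unfolding sum.distrib
        by (subst sum.inter_restrict[symmetric]) (auto simp: F_def Int_def intro!: sum.cong)
      also have "(\<Sum>B\<in>F. t * (c B * w B i)) = 0"
        using c(2) that by (simp add: sum_distrib_left[symmetric])
      finally show ?thesis by simp
    qed
    with x' show ?thesis by auto
  qed
qed

text \<open>After \<open>few_fractional\<close> at most \<open>k\<close> coefficients are changed,
  each by at most 2 and at cost at most \<open>2 * c\<close>.\<close>

lemma round_to_signs:
  fixes w :: "'a \<Rightarrow> nat \<Rightarrow> real"
  assumes "finite S" and "\<forall>B\<in>S. \<bar>x B\<bar> \<le> 1" and "\<forall>B\<in>S. l1_norm k (w B) \<le> c" and "0 \<le> c"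
  obtains s where "\<And>B. \<bar>s B\<bar> = 1"
    and "l1_norm k (\<lambda>i. (\<Sum>B\<in>S. s B * w B i) - (\<Sum>B\<in>S. x B * w B i)) \<le> 2 * c * real k"
proof -
  obtain x' where x': "\<forall>B\<in>S. \<bar>x' B\<bar> \<le> 1" "card {B\<in>S. \<bar>x' B\<bar> \<noteq> 1} \<le> k"
    "\<forall>i<k. (\<Sum>B\<in>S. x' B * w B i) = (\<Sum>B\<in>S. x B * w B i)"
    using few_fractional[OF assms(1,2), of k w] by blast
  define s where "s = (\<lambda>B. if \<bar>x' B\<bar> = 1 then x' B else 1)"
  let ?F = "{B\<in>S. \<bar>x' B\<bar> \<noteq> 1}"
  have "l1_norm k (\<lambda>i. (\<Sum>B\<in>S. s B * w B i) - (\<Sum>B\<in>S. x B * w B i))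
      = l1_norm k (\<lambda>i. \<Sum>B\<in>S. (s B - x' B) * w B i)"
    unfolding l1_norm_def using x'(3)
    by (intro sum.cong) (auto simp: algebra_simps sum_subtractf)
  also have "\<dots> \<le> (\<Sum>B\<in>S. l1_norm k (\<lambda>i. (s B - x' B) * w B i))"
    by (rule l1_norm_sum)
  also have "\<dots> = (\<Sum>B\<in>S. \<bar>s B - x' B\<bar> * l1_norm k (w B))"
    by (simp add: l1_norm_scale)
  also have "\<dots> = (\<Sum>B\<in>?F. \<bar>s B - x' B\<bar> * l1_norm k (w B))"
    using assms(1) by (intro sum.mono_neutral_right) (auto simp: s_def)
  also have "\<dots> \<le> (\<Sum>B\<in>?F. 2 * c)"
    using x'(1) assms(3)
    by (intro sum_mono mult_mono) (auto simp: s_def abs_le_iff l1_norm_def intro!: sum_nonneg)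
  also have "\<dots> = real (card ?F) * (2 * c)" by simp
  also have "\<dots> \<le> 2 * c * real k"
    using x'(2) assms(4) by (simp add: mult.commute mult_left_mono)
  finally show ?thesis
    using that[of s] by (simp add: s_def)
qed

section \<open>Averages over permutations\<close>

definition perm_avg :: "nat \<Rightarrow> ((nat \<Rightarrow> nat) \<Rightarrow> real) \<Rightarrow> real" where
  "perm_avg N f = (\<Sum>p | p permutes {..<N}. f p) / fact N"

lemma perm_avg_cong:
  "(\<And>p. p permutes {..<N} \<Longrightarrow> f p = g p) \<Longrightarrow> perm_avg N f = perm_avg N g"
  by (simp add: perm_avg_def)

lemma perm_avg_add: "perm_avg N (\<lambda>p. f p + g p) = perm_avg N f + perm_avg N g"
  by (simp add: perm_avg_def sum.distrib add_divide_distrib)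

lemma perm_avg_diff: "perm_avg N (\<lambda>p. f p - g p) = perm_avg N f - perm_avg N g"
  by (simp add: perm_avg_def sum_subtractf diff_divide_distrib)

lemma perm_avg_cmult: "perm_avg N (\<lambda>p. c * f p) = c * perm_avg N f"
  by (simp add: perm_avg_def sum_distrib_left)

lemma perm_avg_sum: "perm_avg N (\<lambda>p. \<Sum>j\<in>J. f j p) = (\<Sum>j\<in>J. perm_avg N (f j))"
  unfolding perm_avg_def sum_divide_distrib by (rule sum.swap)

lemma perm_avg_const: "perm_avg N (\<lambda>_. c) = c"
  by (simp add: perm_avg_def card_permutations[OF refl finite_lessThan])

lemma perm_avg_mono:
  "(\<And>p. p permutes {..<N} \<Longrightarrow> f p \<le> g p) \<Longrightarrow> perm_avg N f \<le> perm_avg N g"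
  unfolding perm_avg_def by (intro divide_right_mono sum_mono) auto

lemma perm_avg_nonneg:
  "(\<And>p. p permutes {..<N} \<Longrightarrow> 0 \<le> f p) \<Longrightarrow> 0 \<le> perm_avg N f"
  using perm_avg_mono[of N "\<lambda>_. 0" f] by (simp add: perm_avg_const)

lemma perm_avg_compose:
  assumes "q permutes {..<N}"
  shows "perm_avg N (\<lambda>p. f (p \<circ> q)) = perm_avg N f"
  using sum_permutations_compose_right[OF assms, of f] by (simp add: perm_avg_def)

lemma perm_avg_ge_min:
  assumes "perm_avg N f \<le> c"
  obtains p where "p permutes {..<N}" and "f p \<le> c"
proof (rule ccontr)
  assume "\<not> thesis"
  then have "\<forall>p\<in>{p. p permutes {..<N}}. c < f p"
    using that by fastforce
  moreover have "{p. p permutes {..<N}} \<noteq> {}"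
    using permutes_id by blast
  ultimately have "(\<Sum>p | p permutes {..<N}. c) < (\<Sum>p | p permutes {..<N}. f p)"
    by (intro sum_strict_mono) (auto simp: finite_permutations)
  then have "c < perm_avg N f"
    by (simp add: perm_avg_def card_permutations[OF refl finite_lessThan] field_simps)
  with assms show False by simp
qed

text \<open>Built one point at a time: the transposition of \<open>q x\<close> and \<open>y\<close>
  corrects the image of \<open>x\<close> and fixes \<open>ys\<close>, which contains neither of the
  two.\<close>

lemma permutes_map_list:
  assumes "length xs = length ys" "distinct xs" "distinct ys" "set xs \<subseteq> A" "set ys \<subseteq> A"
  shows "\<exists>q. q permutes A \<and> map q xs = ys"
  using assms
proof (induction rule: list_induct2)
  case Nil
  show ?case by (intro exI[of _ id] conjI permutes_id) simp
next
  case (Cons x xs y ys)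
  then obtain q where q: "q permutes A" "map q xs = ys" by auto
  have qx: "q x \<in> A" "q x \<notin> set ys"
    using Cons.prems q permutes_in_image[OF q(1)]
    by (auto simp: inj_on_eq_iff[OF permutes_inj[OF q(1)]])
  define q' where "q' = transpose (q x) y \<circ> q"
  have "q' permutes A"
    unfolding q'_def using q qx Cons.prems by (intro permutes_compose permutes_swap_id) auto
  moreover have "map q' xs = map (transpose (q x) y) ys"
    by (simp add: q'_def q(2)[symmetric])
  moreover have "\<dots> = ys"
    using qx Cons.prems by (intro map_idI) (auto simp: transpose_def)
  moreover have "q' x = y" by (simp add: q'_def)
  ultimately show ?case by auto
qed

text \<open>A uniformly random permutation composed with a fixed one is again uniform. Stated for
  lists of positions, this covers every joint distribution that occurs below.\<close>

lemma perm_avg_exchange: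
  assumes "length s = length t" "distinct s" "distinct t" "set s \<subseteq> {..<N}" "set t \<subseteq> {..<N}"
  shows "perm_avg N (\<lambda>p. F (map p s)) = perm_avg N (\<lambda>p. F (map p t))"
proof -
  obtain q where q: "q permutes {..<N}" "map q t = s"
    using permutes_map_list[of t s "{..<N}"] assms by auto
  have "perm_avg N (\<lambda>p. F (map p s)) = perm_avg N (\<lambda>p. F (map (p \<circ> q) t))"
    by (simp add: q(2)[symmetric])
  also have "\<dots> = perm_avg N (\<lambda>p. F (map p t))"
    by (rule perm_avg_compose[OF q(1), of "\<lambda>p. F (map p t)"])
  finally show ?thesis .
qed

section \<open>Ordered quadruples and the covariance of disjoint ones\<close>

definition quads :: "nat set \<Rightarrow> nat list set" where
  "quads A = {t. length t = 4 \<and> distinct t \<and> set t \<subseteq> A}"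

lemma finite_quads: "finite A \<Longrightarrow> finite (quads A)"
  unfolding quads_def by (rule finite_subset[OF _ finite_lists_length_eq[of A 4]]) auto

lemma card_quads:
  assumes "finite A" "card A \<ge> 4"
  shows "real (card (quads A)) =
    real (card A) * (real (card A) - 1) * (real (card A) - 2) * (real (card A) - 3)"
proof -
  obtain r where r: "card A = r + 4" using assms(2) by (metis add.commute le_Suc_ex)
  have "card (quads A) = \<Prod>{card A - 4 + 1..card A}"
    unfolding quads_def using assms by (intro card_lists_distinct_length_eq) auto
  also have "{card A - 4 + 1..card A} = {r+1, r+2, r+3, r+4}"
    using r by auto
  finally have "card (quads A) = (r+1)*((r+2)*((r+3)*(r+4)))" by simp
  then show ?thesis by (simp add: r algebra_simps)
qed

lemma sum_quads_permute:
  assumes "p permutes {..<N}"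
  shows "(\<Sum>t\<in>quads {..<N}. F (map p t)) = (\<Sum>t\<in>quads {..<N}. F t)"
proof (rule sum.reindex_bij_witness[where i = "map (inv p)" and j = "map p"])
  fix t assume t: "t \<in> quads {..<N}"
  show "map (inv p) (map p t) = t" "map p (map (inv p) t) = t"
    using permutes_inverses[OF assms] by (simp_all add: o_def)
  show "map p t \<in> quads {..<N}"
    using t permutes_in_image[OF assms] inj_on_subset[OF permutes_inj[OF assms]]
    by (auto simp: quads_def distinct_map)
  show "map (inv p) t \<in> quads {..<N}"
    using t permutes_in_image[OF permutes_inv[OF assms]]
      inj_on_subset[OF permutes_inj[OF permutes_inv[OF assms]]]
    by (auto simp: quads_def distinct_map)
qed simp

text \<open>The sum of \<open>F\<close> over all quadruples vanishes; multiplying by \<open>F\<close> of one quadruple leaves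
  the disjoint quadruples, which all contribute equally, and at most \<open>16 N\<^sup>3\<close> intersecting ones.\<close>

lemma disjoint_quads_covariance:
  assumes N: "N \<ge> 8" and s: "s \<in> quads {..<N}" and t: "t \<in> quads ({..<N} - set s)"
    and mean: "perm_avg N (\<lambda>p. F (map p s)) = 0"
  shows "(real N - 4) * (real N - 5) * (real N - 6) * (real N - 7)
      * perm_avg N (\<lambda>p. F (map p s) * F (map p t))
    \<le> 16 * real N ^ 3 * perm_avg N (\<lambda>p. (F (map p s))\<^sup>2)"
proof -
  let ?Q = "quads {..<N}" and ?D = "quads ({..<N} - set s)"
  let ?E = "\<lambda>u. perm_avg N (\<lambda>p. F (map p s) * F (map p u))"
  define v where "v = perm_avg N (\<lambda>p. (F (map p s))\<^sup>2)"
  have fin: "finite ?Q" "finite ?D" by (auto intro!: finite_quads)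
  have sub: "?D \<subseteq> ?Q" by (auto simp: quads_def)
  have card_s: "card (set s) = 4" "set s \<subseteq> {..<N}"
    using s by (auto simp: quads_def distinct_card)
  have card_rest: "card ({..<N} - set s) = N - 4"
    using card_s by (simp add: card_Diff_subset)
  have v: "v \<ge> 0" by (simp add: v_def perm_avg_nonneg)
  have second_moment: "perm_avg N (\<lambda>p. (F (map p u))\<^sup>2) = v" if "u \<in> ?Q" for u
    unfolding v_def using that s
    by (intro perm_avg_exchange[where F = "\<lambda>u. (F u)\<^sup>2"]) (auto simp: quads_def)
  have "(\<Sum>u\<in>?Q. F u) = perm_avg N (\<lambda>p. \<Sum>u\<in>?Q. F (map p u))"
    by (simp add: perm_avg_const sum_quads_permute cong: perm_avg_cong)
  also have "\<dots> = (\<Sum>u\<in>?Q. perm_avg N (\<lambda>p. F (map p u)))" by (rule perm_avg_sum)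
  also have "\<dots> = 0"
  proof (rule sum.neutral, rule ballI)
    fix u assume "u \<in> ?Q"
    then have "perm_avg N (\<lambda>p. F (map p u)) = perm_avg N (\<lambda>p. F (map p s))"
      using s by (intro perm_avg_exchange) (auto simp: quads_def)
    with mean show "perm_avg N (\<lambda>p. F (map p u)) = 0" by simp
  qed
  finally have total: "(\<Sum>u\<in>?Q. F u) = 0" .
  have "(\<Sum>u\<in>?Q. ?E u) = perm_avg N (\<lambda>p. F (map p s) * (\<Sum>u\<in>?Q. F (map p u)))"
    by (simp add: perm_avg_sum sum_distrib_left)
  also have "\<dots> = perm_avg N (\<lambda>_. 0)"
    by (rule perm_avg_cong) (simp add: sum_quads_permute total)
  finally have "(\<Sum>u\<in>?Q. ?E u) = 0" by (simp add: perm_avg_const)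
  moreover have "(\<Sum>u\<in>?Q. ?E u) = (\<Sum>u\<in>?D. ?E u) + (\<Sum>u\<in>?Q - ?D. ?E u)"
    using sum.subset_diff[OF sub fin(1), of ?E] by simp
  moreover have "(\<Sum>u\<in>?D. ?E u) = real (card ?D) * ?E t"
  proof -
    have "?E u = ?E t" if u: "u \<in> ?D" for u
    proof -
      \<comment> \<open>The pair is encoded as one list of eight distinct positions, so that
        exchangeability applies to the product.\<close>
      have "perm_avg N (\<lambda>p. (\<lambda>xs. F (take 4 xs) * F (drop 4 xs)) (map p (s @ u)))
        = perm_avg N (\<lambda>p. (\<lambda>xs. F (take 4 xs) * F (drop 4 xs)) (map p (s @ t)))"
        using s t u by (intro perm_avg_exchange) (auto simp: quads_def)
      then show ?thesis
        using s by (simp add: quads_def)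
    qed
    then show ?thesis by simp
  qed
  moreover have "- (real (card (?Q - ?D)) * v) \<le> (\<Sum>u\<in>?Q - ?D. ?E u)"
  proof -
    have "- v \<le> ?E u" if "u \<in> ?Q" for u
    proof -
      \<comment> \<open>The arithmetic-geometric mean inequality: an intersecting quadruple
        contributes at least \<open>- v\<close>.\<close>
      have "- ((1/2) * (F (map p s))\<^sup>2 + (1/2) * (F (map p u))\<^sup>2) \<le> F (map p s) * F (map p u)" for p
        using zero_le_power2[of "F (map p s) + F (map p u)"]
        by (simp add: power2_sum)
      then have "perm_avg N (\<lambda>p. (- 1) * ((1/2) * (F (map p s))\<^sup>2 + (1/2) * (F (map p u))\<^sup>2)) \<le> ?E u"
        by (intro perm_avg_mono) simp
      then show ?thesis
        using second_moment[OF s] second_moment[OF that]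
        by (simp only: perm_avg_cmult perm_avg_add) simp
    qed
    then have "(\<Sum>u\<in>?Q - ?D. - v) \<le> (\<Sum>u\<in>?Q - ?D. ?E u)"
      by (intro sum_mono) auto
    then show ?thesis by simp
  qed
  ultimately have "real (card ?D) * ?E t \<le> real (card (?Q - ?D)) * v" by linarith
  also have "real (card (?Q - ?D)) = real (card ?Q) - real (card ?D)"
    using sub fin by (simp add: card_Diff_subset card_mono of_nat_diff)
  also have "\<dots> \<le> 16 * real N ^ 3"
  proof -
    \<comment> \<open>The quartic terms of the two counts cancel, and for \<open>N \<ge> 8\<close>
      the quadratic term outweighs the linear one.\<close>
    have "168 * real N ^ 2 \<ge> 168 * (8 * real N)"
      using N by (simp add: power2_eq_square)
    moreover have "real (card ?Q) - real (card ?D)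
        = 16 * real N ^ 3 - 168 * real N ^ 2 + 632 * real N - 840"
      using N by (simp add: card_quads card_rest of_nat_diff)
        (simp add: algebra_simps power2_eq_square power3_eq_cube)
    ultimately show ?thesis by simp
  qed
  finally have "real (card ?D) * ?E t \<le> 16 * real N ^ 3 * v"
    using v by (auto simp: mult_right_mono)
  moreover have "real (card ?D) = (real N - 4) * (real N - 5) * (real N - 6) * (real N - 7)"
    using N by (simp add: card_quads card_rest of_nat_diff)
  ultimately show ?thesis by (simp add: v_def)
qed

section \<open>Variance of a sum over blocks of four consecutive positions\<close>

definition block :: "nat \<Rightarrow> nat list" where
  "block B = [4 * B, 4 * B + 1, 4 * B + 2, 4 * B + 3]"

lemma block_quads: "4 * B + 4 \<le> N \<Longrightarrow> block B \<in> quads {..<N}"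
  by (simp add: block_def quads_def)

lemma block_disjoint: "B \<noteq> B' \<Longrightarrow> set (block B) \<inter> set (block B') = {}"
  by (auto simp: block_def)

lemma block_avg:
  assumes "4 * B + 4 \<le> N"
  shows "perm_avg N (\<lambda>p. F (map p (block B))) = perm_avg N (\<lambda>p. F (map p (block 0)))"
  using block_quads[OF assms] block_quads[of 0 N] assms
  by (intro perm_avg_exchange) (auto simp: quads_def)

text \<open>Expand the square of the centred sum. A diagonal term is the variance \<open>v\<close>
  of one block and an off-diagonal term is at most \<open>7 * v / m\<close>, so each of the
  \<open>m\<close> rows sums to at most \<open>8 * v\<close>.\<close>

lemma block_sum_variance:
  assumes N: "N \<ge> 64" and m: "4 * m \<le> N"
  shows "perm_avg N (\<lambda>p. ((\<Sum>B<m. F (map p (block B)))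
        - real m * perm_avg N (\<lambda>p. F (map p (block 0))))\<^sup>2)
    \<le> 8 * real m * perm_avg N (\<lambda>p. (F (map p (block 0)))\<^sup>2)"
proof -
  define \<mu> where "\<mu> = perm_avg N (\<lambda>p. F (map p (block 0)))"
  define H where "H = (\<lambda>t. F t - \<mu>)"
  define v where "v = perm_avg N (\<lambda>p. (H (map p (block 0)))\<^sup>2)"
  have v0: "v \<ge> 0" by (simp add: v_def perm_avg_nonneg)
  have H_mean: "perm_avg N (\<lambda>p. H (map p (block 0))) = 0"
    by (simp add: H_def perm_avg_diff perm_avg_const \<mu>_def)
  have v_le: "v \<le> perm_avg N (\<lambda>p. (F (map p (block 0)))\<^sup>2)"
  proof -
    have "v = perm_avg N (\<lambda>p. (F (map p (block 0)))\<^sup>2 - (2 * \<mu>) * F (map p (block 0)) + \<mu>\<^sup>2)"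
      by (simp add: v_def H_def power2_diff algebra_simps)
    also have "\<dots> = perm_avg N (\<lambda>p. (F (map p (block 0)))\<^sup>2) - \<mu>\<^sup>2"
      by (simp only: perm_avg_add perm_avg_diff perm_avg_cmult perm_avg_const \<mu>_def[symmetric])
        (simp add: power2_eq_square)
    finally show ?thesis by simp
  qed
  have B_le: "4 * B + 4 \<le> N" if "B < m" for B using that m by simp
  have diag: "perm_avg N (\<lambda>p. H (map p (block B)) * H (map p (block B))) = v" if "B < m" for B
    unfolding v_def power2_eq_square
    by (rule block_avg[OF B_le[OF that], where F = "\<lambda>t. H t * H t"])
  define K where "K = (real N - 4) * (real N - 5) * (real N - 6) * (real N - 7)"
  \<comment> \<open>Together with \<open>4 * m \<le> N\<close> this turns the factor
    \<open>16 * N ^ 3 / K\<close> of the covariance bound into \<open>7 / m\<close>. In the variable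
    \<open>r = N - 64\<close> all coefficients of the difference are positive.\<close>
  have K: "4 * real N ^ 4 \<le> 7 * K"
  proof -
    define r where "r = real N - 64"
    have r: "r \<ge> 0" "real N = r + 64" using N by (simp_all add: r_def)
    show ?thesis
      unfolding K_def r(2) using r(1)
      by (simp add: algebra_simps power4_eq_xxxx)
  qed
  have K0: "K > 0" using N by (simp add: K_def)
  have off: "real m * perm_avg N (\<lambda>p. H (map p (block B)) * H (map p (block B'))) \<le> 7 * v"
    if B: "B < m" "B' < m" "B \<noteq> B'" for B B'
  proof -
    let ?c = "perm_avg N (\<lambda>p. H (map p (block B)) * H (map p (block B')))"
    have "K * ?c \<le> 16 * real N ^ 3 * perm_avg N (\<lambda>p. (H (map p (block B)))\<^sup>2)"
      unfolding K_def
    proof (rule disjoint_quads_covariance)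
      show "block B' \<in> quads ({..<N} - set (block B))"
        using block_quads[OF B_le[OF B(2)]] block_disjoint[OF B(3)] by (auto simp: quads_def)
      show "perm_avg N (\<lambda>p. H (map p (block B))) = 0"
        using block_avg[OF B_le[OF B(1)], of H] H_mean by simp
    qed (use N block_quads[OF B_le[OF B(1)]] in auto)
    also have "perm_avg N (\<lambda>p. (H (map p (block B)))\<^sup>2) = v"
      using diag[OF B(1)] by (simp add: power2_eq_square)
    finally have "real m * (K * ?c) \<le> real m * (16 * real N ^ 3 * v)"
      by (rule mult_left_mono) simp
    also have "\<dots> = (4 * real m) * (4 * real N ^ 3 * v)" by simp
    also have "\<dots> \<le> real N * (4 * real N ^ 3 * v)"
      using m v0 by (intro mult_right_mono) auto
    also have "\<dots> = (4 * real N ^ 4) * v" by (simp add: power4_eq_xxxx power3_eq_cube)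
    also have "\<dots> \<le> (7 * K) * v" using K v0 by (rule mult_right_mono)
    finally have "K * (real m * ?c) \<le> K * (7 * v)" by (simp add: ac_simps)
    then show ?thesis using K0 by simp
  qed
  have "perm_avg N (\<lambda>p. ((\<Sum>B<m. F (map p (block B))) - real m * \<mu>)\<^sup>2)
      = perm_avg N (\<lambda>p. \<Sum>B<m. \<Sum>B'<m. H (map p (block B)) * H (map p (block B')))"
    by (simp add: H_def sum_subtractf power2_eq_square sum_product[symmetric])
  also have "\<dots> = (\<Sum>B<m. \<Sum>B'<m. perm_avg N (\<lambda>p. H (map p (block B)) * H (map p (block B'))))"
    by (simp add: perm_avg_sum)
  also have "\<dots> \<le> (\<Sum>B<m. 8 * v)"
  proof (rule sum_mono)
    fix B assume "B \<in> {..<m}"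
    then have B: "B < m" by simp
    have "(\<Sum>B'<m. perm_avg N (\<lambda>p. H (map p (block B)) * H (map p (block B'))))
        \<le> (\<Sum>B'<m. (if B' = B then v else 0) + 7 * v / real m)"
    proof (rule sum_mono)
      fix B' assume "B' \<in> {..<m}"
      then show "perm_avg N (\<lambda>p. H (map p (block B)) * H (map p (block B')))
          \<le> (if B' = B then v else 0) + 7 * v / real m"
        using diag[OF B] off[OF B, of B'] v0 B by (auto simp: field_simps)
    qed
    also have "\<dots> = 8 * v" using B by (simp add: sum.distrib)
    finally show "(\<Sum>B'<m. perm_avg N (\<lambda>p. H (map p (block B)) * H (map p (block B')))) \<le> 8 * v" .
  qed
  also have "\<dots> \<le> 8 * real m * perm_avg N (\<lambda>p. (F (map p (block 0)))\<^sup>2)"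
    using mult_left_mono[OF v_le, of "8 * real m"] by (simp add: ac_simps)
  finally show ?thesis by (simp add: \<mu>_def)
qed

section \<open>Covariances of symmetric edge weights with zero row sums\<close>

locale zero_row_sums =
  fixes N :: nat and \<phi> :: "nat \<Rightarrow> nat \<Rightarrow> real"
  assumes N4: "4 \<le> N"
    and sym: "\<phi> u v = \<phi> v u"
    and row: "u < N \<Longrightarrow> (\<Sum>v\<in>{..<N} - {u}. \<phi> u v) = 0"
begin

text \<open>The arguments are positions in a random order. For two pairs of distinct positions the
  value depends only on whether the pairs coincide, share one position or are disjoint.\<close>

definition cov :: "nat \<Rightarrow> nat \<Rightarrow> nat \<Rightarrow> nat \<Rightarrow> real" where
  "cov i j l q = perm_avg N (\<lambda>p. \<phi> (p i) (p j) * \<phi> (p l) (p q))"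

definition var :: real where
  "var = cov 0 1 0 1"

lemma var_nonneg: "0 \<le> var"
  by (simp add: var_def cov_def perm_avg_nonneg)

lemma cov_swap: "cov i j l q = cov j i l q" "cov i j l q = cov i j q l"
  by (simp_all add: cov_def sym)

lemma cov_same:
  assumes "i < N" "j < N" "i \<noteq> j"
  shows "cov i j i j = var"
  unfolding cov_def var_def
  using perm_avg_exchange[of "[i,j]" "[0,1]" N "\<lambda>xs. \<phi> (xs!0) (xs!1) * \<phi> (xs!0) (xs!1)"] assms N4
  by simp

text \<open>For fixed \<open>p\<close> the inner sum runs over a full row of \<open>\<phi>\<close>.
  Taking \<open>l\<close> first inside and then outside the pair \<open>i, j\<close> gives the
  linear equations that express the adjacent and disjoint covariances through
  \<open>var\<close>.\<close>

lemma cov_row: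
  assumes "l < N"
  shows "(\<Sum>q\<in>{..<N} - {l}. cov i j l q) = 0"
proof -
  have "(\<Sum>q\<in>{..<N} - {l}. cov i j l q)
      = perm_avg N (\<lambda>p. \<phi> (p i) (p j) * (\<Sum>q\<in>{..<N} - {l}. \<phi> (p l) (p q)))"
    by (simp add: cov_def perm_avg_sum sum_distrib_left)
  also have "\<dots> = perm_avg N (\<lambda>_. 0)"
  proof (rule perm_avg_cong)
    fix p assume p: "p permutes {..<N}"
    have "p ` ({..<N} - {l}) = {..<N} - {p l}"
      using permutes_image[OF p] permutes_inj[OF p] by (simp add: image_set_diff)
    then have "bij_betw p ({..<N} - {l}) ({..<N} - {p l})"
      using permutes_inj_on[OF p] by (simp add: bij_betw_def)
    then have "(\<Sum>q\<in>{..<N} - {l}. \<phi> (p l) (p q)) = (\<Sum>v\<in>{..<N} - {p l}. \<phi> (p l) v)"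
      by (rule sum.reindex_bij_betw)
    also have "\<dots> = 0"
      using row permutes_in_image[OF p, of l] assms by simp
    finally show "\<phi> (p i) (p j) * (\<Sum>q\<in>{..<N} - {l}. \<phi> (p l) (p q)) = 0" by simp
  qed
  finally show ?thesis by (simp add: perm_avg_const)
qed

lemma cov_adjacent:
  assumes "distinct [i, j, l]" "{i, j, l} \<subseteq> {..<N}"
  shows "(real N - 2) * cov i j i l = - var"
proof -
  have same: "cov i j i q = cov i j i l" if "q \<in> {..<N} - {i} - {j}" for q
    unfolding cov_def
    using perm_avg_exchange[of "[i,j,q]" "[i,j,l]" N "\<lambda>xs. \<phi> (xs!0) (xs!1) * \<phi> (xs!0) (xs!2)"]
      assms that by simp
  have "0 = (\<Sum>q\<in>{..<N} - {i}. cov i j i q)"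
    using cov_row assms by simp
  also have "\<dots> = cov i j i j + (\<Sum>q\<in>{..<N} - {i} - {j}. cov i j i q)"
    using assms by (intro sum.remove) auto
  also have "(\<Sum>q\<in>{..<N} - {i} - {j}. cov i j i q) = (\<Sum>q\<in>{..<N} - {i} - {j}. cov i j i l)"
    by (rule sum.cong[OF refl same])
  also have "cov i j i j = var"
    using cov_same assms by simp
  also have "(\<Sum>q\<in>{..<N} - {i} - {j}. cov i j i l) = (real N - 2) * cov i j i l"
    using assms N4 by (simp add: of_nat_diff)
  finally show ?thesis by simp
qed

lemma cov_disjoint:
  assumes "distinct [i, j, l, q]" "{i, j, l, q} \<subseteq> {..<N}"
  shows "(real N - 2) * (real N - 3) * cov i j l q = 2 * var"
proof -
  have same: "cov i j l r = cov i j l q" if "r \<in> {..<N} - {l} - {i} - {j}" for r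
    unfolding cov_def
    using perm_avg_exchange[of "[i,j,l,r]" "[i,j,l,q]" N "\<lambda>xs. \<phi> (xs!0) (xs!1) * \<phi> (xs!2) (xs!3)"]
      assms that by simp
  have "0 = (\<Sum>r\<in>{..<N} - {l}. cov i j l r)"
    using cov_row assms by simp
  also have "\<dots> = cov i j l i + (\<Sum>r\<in>{..<N} - {l} - {i}. cov i j l r)"
    using assms by (intro sum.remove) auto
  also have "(\<Sum>r\<in>{..<N} - {l} - {i}. cov i j l r)
      = cov i j l j + (\<Sum>r\<in>{..<N} - {l} - {i} - {j}. cov i j l r)"
    using assms by (intro sum.remove) auto
  also have "(\<Sum>r\<in>{..<N} - {l} - {i} - {j}. cov i j l r)
      = (\<Sum>r\<in>{..<N} - {l} - {i} - {j}. cov i j l q)"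
    by (rule sum.cong[OF refl same])
  also have "\<dots> = (real N - 3) * cov i j l q"
    using assms N4 by (simp add: of_nat_diff)
  finally have "0 = (real N - 2) * (cov i j i l + (cov j i j l + (real N - 3) * cov i j l q))"
    using N4 by (simp add: of_nat_diff cov_swap(2)[of i j l i] cov_swap(2)[of i j l j]
        cov_swap(1)[of i j j l])
  moreover have "(real N - 2) * cov i j i l = - var" "(real N - 2) * cov j i j l = - var"
    using assms by (auto intro!: cov_adjacent)
  ultimately show ?thesis by (simp add: algebra_simps)
qed

text \<open>Each of the \<open>n\<close> edges contributes \<open>var\<close> by itself, and its
  covariances with the other \<open>n - 1\<close> edges add up to at most \<open>var\<close>
  more.\<close>

lemma matching_second_moment:
  assumes "N = 2 * n"
  shows "perm_avg N (\<lambda>p. (\<Sum>i<n. \<phi> (p (2 * i)) (p (2 * i + 1)))\<^sup>2) \<le> 2 * real n * var"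
proof -
  have n: "n \<ge> 2" using N4 assms by simp
  have "perm_avg N (\<lambda>p. (\<Sum>i<n. \<phi> (p (2 * i)) (p (2 * i + 1)))\<^sup>2)
      = (\<Sum>i<n. \<Sum>j<n. cov (2 * i) (2 * i + 1) (2 * j) (2 * j + 1))"
    by (simp add: cov_def power2_eq_square sum_product perm_avg_sum)
  also have "\<dots> \<le> (\<Sum>i<n. 2 * var)"
  proof (rule sum_mono)
    fix i assume "i \<in> {..<n}"
    then have i: "i < n" by simp
    have "cov (2 * i) (2 * i + 1) (2 * j) (2 * j + 1) \<le> var / (real n - 1)"
      if j: "j \<in> {..<n} - {i}" for j
    proof -
      have "2 * i + 1 \<noteq> 2 * j" "2 * i \<noteq> 2 * j + 1" by presburger+
      then have "(real N - 2) * (real N - 3) * cov (2 * i) (2 * i + 1) (2 * j) (2 * j + 1) = 2 * var"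
        using i j assms by (intro cov_disjoint) auto
      then have "(2 * real n - 3) * ((real n - 1) * cov (2 * i) (2 * i + 1) (2 * j) (2 * j + 1)) = var"
        using assms by (simp add: algebra_simps)
      moreover define t where "t = (real n - 1) * cov (2 * i) (2 * i + 1) (2 * j) (2 * j + 1)"
      ultimately have t: "(2 * real n - 3) * t = var" by simp
      then have "0 \<le> (2 * real n - 3) * t" using var_nonneg by simp
      moreover have "0 < 2 * real n - 3" using n by simp
      ultimately have "t \<ge> 0" by (simp only: zero_le_mult_iff) auto
      \<comment> \<open>As \<open>2 * n - 3 \<ge> 1\<close>, the identity
        \<open>(2 * n - 3) * t = var\<close> gives \<open>t \<le> var\<close>.\<close>
      then have "1 * t \<le> (2 * real n - 3) * t"
        using n by (intro mult_right_mono) auto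
      then show ?thesis using t n by (simp add: t_def field_simps)
    qed
    then have "(\<Sum>j\<in>{..<n} - {i}. cov (2 * i) (2 * i + 1) (2 * j) (2 * j + 1))
        \<le> (\<Sum>j\<in>{..<n} - {i}. var / (real n - 1))"
      by (rule sum_mono)
    also have "\<dots> = var"
      using i n by (simp add: of_nat_diff)
    finally show "(\<Sum>j<n. cov (2 * i) (2 * i + 1) (2 * j) (2 * j + 1)) \<le> 2 * var"
      using i assms sum.remove[of "{..<n}" i "\<lambda>j. cov (2 * i) (2 * i + 1) (2 * j) (2 * j + 1)"]
        cov_same[of "2 * i" "2 * i + 1"]
      by simp
  qed
  also have "\<dots> = 2 * real n * var" by simp
  finally show ?thesis .
qed

text \<open>The four squares already give \<open>var\<close>. Disjoint pairs enter with a plus sign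
  and have nonnegative covariance, adjacent pairs enter with a minus sign and have nonpositive
  covariance, so no cross term hurts.\<close>

lemma half_swap_second_moment:
  "var \<le> perm_avg N (\<lambda>p. ((\<phi> (p 0) (p 1) + \<phi> (p 2) (p 3) - \<phi> (p 0) (p 2) - \<phi> (p 1) (p 3)) / 2)\<^sup>2)"
proof -
  \<comment> \<open>Adjacent edges are oriented to share their first position, as in
    \<open>cov_adjacent\<close>.\<close>
  have pointwise: "((\<phi> (p 0) (p 1) + \<phi> (p 2) (p 3) - \<phi> (p 0) (p 2) - \<phi> (p 1) (p 3)) / 2)\<^sup>2
    = (1/4) * (\<phi> (p 0) (p 1) * \<phi> (p 0) (p 1)) + (1/4) * (\<phi> (p 2) (p 3) * \<phi> (p 2) (p 3))
    + (1/4) * (\<phi> (p 0) (p 2) * \<phi> (p 0) (p 2)) + (1/4) * (\<phi> (p 1) (p 3) * \<phi> (p 1) (p 3))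
    + (1/2) * (\<phi> (p 0) (p 1) * \<phi> (p 2) (p 3)) + (1/2) * (\<phi> (p 0) (p 2) * \<phi> (p 1) (p 3))
    - (1/2) * (\<phi> (p 0) (p 1) * \<phi> (p 0) (p 2)) - (1/2) * (\<phi> (p 1) (p 0) * \<phi> (p 1) (p 3))
    - (1/2) * (\<phi> (p 2) (p 3) * \<phi> (p 2) (p 0)) - (1/2) * (\<phi> (p 3) (p 2) * \<phi> (p 3) (p 1))" for p :: "nat \<Rightarrow> nat"
    by (simp add: power2_eq_square field_simps sym[of "p (Suc 0)" "p 0"] sym[of "p 2" "p 0"]
        sym[of "p 3" "p 2"] sym[of "p 3" "p (Suc 0)"])
  have "perm_avg N (\<lambda>p. ((\<phi> (p 0) (p 1) + \<phi> (p 2) (p 3) - \<phi> (p 0) (p 2) - \<phi> (p 1) (p 3)) / 2)\<^sup>2)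
    = (1/4) * cov 0 1 0 1 + (1/4) * cov 2 3 2 3 + (1/4) * cov 0 2 0 2 + (1/4) * cov 1 3 1 3
    + (1/2) * cov 0 1 2 3 + (1/2) * cov 0 2 1 3
    - (1/2) * cov 0 1 0 2 - (1/2) * cov 1 0 1 3 - (1/2) * cov 2 3 2 0 - (1/2) * cov 3 2 3 1"
    unfolding pointwise by (simp only: perm_avg_add perm_avg_diff perm_avg_cmult cov_def)
  moreover have "cov 0 1 0 1 = var" "cov 2 3 2 3 = var" "cov 0 2 0 2 = var" "cov 1 3 1 3 = var"
    using N4 by (simp_all add: cov_same)
  moreover have "cov i j l q \<ge> 0" if "distinct [i, j, l, q]" "{i, j, l, q} \<subseteq> {..<N}" for i j l q
  proof -
    have "0 \<le> (real N - 2) * (real N - 3) * cov i j l q"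
      using cov_disjoint[OF that] var_nonneg by simp
    moreover have "0 < (real N - 2) * (real N - 3)" using N4 by simp
    ultimately show ?thesis by (simp only: zero_le_mult_iff) auto
  qed
  then have "cov 0 1 2 3 \<ge> 0" "cov 0 2 1 3 \<ge> 0" using N4 by auto
  moreover have "cov i j i l \<le> 0" if "distinct [i, j, l]" "{i, j, l} \<subseteq> {..<N}" for i j l
  proof -
    have "(real N - 2) * cov i j i l \<le> 0"
      using cov_adjacent[OF that] var_nonneg by simp
    moreover have "0 < real N - 2" using N4 by simp
    ultimately show ?thesis by (simp only: mult_le_0_iff) auto
  qed
  then have "cov 0 1 0 2 \<le> 0" "cov 1 0 1 3 \<le> 0" "cov 2 3 2 0 \<le> 0" "cov 3 2 3 1 \<le> 0"
    using N4 by auto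
  ultimately show ?thesis by linarith
qed

end

section \<open>Zero-sum edge vectors\<close>

definition swap_blocks :: "nat \<Rightarrow> nat set \<Rightarrow> nat \<Rightarrow> nat" where
  "swap_blocks m S j =
     (if j < 4 * m \<and> j div 4 \<in> S
      then (if j mod 4 = 1 then j + 1 else if j mod 4 = 2 then j - 1 else j) else j)"

text \<open>Exchanging the two middle positions turns the edges \<open>ab, cd\<close> of the block
  into \<open>ac, bd\<close>.\<close>

lemma swap_blocks_block:
  assumes "B < m"
  shows "swap_blocks m S (4 * B) = 4 * B"
    and "swap_blocks m S (4 * B + 1) = (if B \<in> S then 4 * B + 2 else 4 * B + 1)"
    and "swap_blocks m S (4 * B + 2) = (if B \<in> S then 4 * B + 1 else 4 * B + 2)"
    and "swap_blocks m S (4 * B + 3) = 4 * B + 3"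
proof -
  have "(4 * B + 1) div 4 = B" "(4 * B + 2) div 4 = B" "(4 * B + 3) div 4 = B"
    "(4 * B + 1) mod 4 = 1" "(4 * B + 2) mod 4 = 2" "(4 * B + 3) mod 4 = 3"
    by presburger+
  with assms show "swap_blocks m S (4 * B) = 4 * B"
    and "swap_blocks m S (4 * B + 1) = (if B \<in> S then 4 * B + 2 else 4 * B + 1)"
    and "swap_blocks m S (4 * B + 2) = (if B \<in> S then 4 * B + 1 else 4 * B + 2)"
    and "swap_blocks m S (4 * B + 3) = 4 * B + 3"
    unfolding swap_blocks_def by simp_all
qed

lemma swap_blocks_ge: "4 * m \<le> j \<Longrightarrow> swap_blocks m S j = j"
  by (simp add: swap_blocks_def)

lemma swap_blocks_involution: "swap_blocks m S (swap_blocks m S j) = j"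
proof (cases "j < 4 * m")
  case True
  define B where "B = j div 4"
  have B: "B < m" using True by (simp add: B_def less_mult_imp_div_less mult.commute)
  have "j = 4 * B \<or> j = 4 * B + 1 \<or> j = 4 * B + 2 \<or> j = 4 * B + 3"
    unfolding B_def by presburger
  then show ?thesis
    using swap_blocks_block[OF B, of S] by (elim disjE) (simp_all split: if_splits)
next
  case False
  then show ?thesis by (simp add: swap_blocks_ge)
qed

lemma swap_blocks_permutes:
  assumes "4 * m \<le> N"
  shows "swap_blocks m S permutes {..<N}"
proof -
  have "swap_blocks m S j = j" if "j \<notin> {..<N}" for j
    using that assms by (simp add: swap_blocks_ge)
  moreover have "\<exists>!i. swap_blocks m S i = j" for j
    by (metis swap_blocks_involution)
  ultimately show ?thesis by (auto simp: permutes_def)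
qed

lemma sum_lessThan_double: "(\<Sum>j<2 * (m::nat). f j) = (\<Sum>B<m. f (2 * B) + f (2 * B + 1) :: real)"
  by (induction m) (simp_all add: add.assoc)

text \<open>The bound on \<open>n\<close> supplies the \<open>N \<ge> 64\<close> of
  \<open>block_sum_variance\<close>; the bound 5 allows 1 for the original edge vector and 2 for the
  potential at each end.\<close>

locale zero_sum_vectors =
  fixes n k :: nat and g :: "nat \<Rightarrow> nat \<Rightarrow> nat \<Rightarrow> real"
  assumes n: "32 \<le> n"
    and k: "0 < k"
    and g_sym: "g u v = g v u"
    and g_row: "\<lbrakk>u < 2 * n; i < k\<rbrakk> \<Longrightarrow> (\<Sum>v\<in>{..<2 * n} - {u}. g u v i) = 0"
    and g_bound: "\<lbrakk>u < 2 * n; v < 2 * n; u \<noteq> v\<rbrakk> \<Longrightarrow> l1_norm k (g u v) \<le> 5"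
begin

abbreviation "N \<equiv> 2 * n"
abbreviation "m \<equiv> n div 2"

definition msum :: "(nat \<Rightarrow> nat) \<Rightarrow> nat \<Rightarrow> real" where
  "msum p i = (\<Sum>j<n. g (p (2 * j)) (p (2 * j + 1)) i)"

text \<open>Half the difference of the two matchings \<open>ab, cd\<close> and \<open>ac, bd\<close> of a block.\<close>

definition half :: "nat list \<Rightarrow> nat \<Rightarrow> real" where
  "half t i = (g (t!0) (t!1) i + g (t!2) (t!3) i - g (t!0) (t!2) i - g (t!1) (t!3) i) / 2"

abbreviation W :: "(nat \<Rightarrow> nat) \<Rightarrow> nat \<Rightarrow> nat \<Rightarrow> real" where
  "W p B \<equiv> half (map p (block B))"

text \<open>The part \<open>D\<close> common to all sign choices. Written as the mean of two
  matching sums, it inherits the second moment bound of a random matching by convexity.\<close>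

definition centre :: "(nat \<Rightarrow> nat) \<Rightarrow> nat \<Rightarrow> real" where
  "centre p i = (msum p i + msum (p \<circ> swap_blocks m UNIV) i) / 2"

lemma m: "4 * m \<le> N" "0 < m" "real n \<le> 3 * real m"
  using n by auto

lemma msum_split:
  "msum (p \<circ> swap_blocks m S) i =
     (\<Sum>B<m. if B \<in> S
        then g (p (4 * B)) (p (4 * B + 2)) i + g (p (4 * B + 1)) (p (4 * B + 3)) i
        else g (p (4 * B)) (p (4 * B + 1)) i + g (p (4 * B + 2)) (p (4 * B + 3)) i)
     + (\<Sum>j\<in>{2 * m..<n}. g (p (2 * j)) (p (2 * j + 1)) i)"
proof -
  let ?q = "swap_blocks m S"
  let ?f = "\<lambda>j. g (p (?q (2 * j))) (p (?q (2 * j + 1))) i"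
  have "msum (p \<circ> ?q) i = (\<Sum>j<2 * m. ?f j) + (\<Sum>j\<in>{2 * m..<n}. ?f j)"
    unfolding msum_def
    by (subst sum.union_disjoint[symmetric]) (auto intro!: sum.cong)
  also have "(\<Sum>j<2 * m. ?f j) = (\<Sum>B<m. ?f (2 * B) + ?f (2 * B + 1))"
    by (rule sum_lessThan_double)
  also have "\<dots> = (\<Sum>B<m. if B \<in> S
        then g (p (4 * B)) (p (4 * B + 2)) i + g (p (4 * B + 1)) (p (4 * B + 3)) i
        else g (p (4 * B)) (p (4 * B + 1)) i + g (p (4 * B + 2)) (p (4 * B + 3)) i)"
  proof (rule sum.cong[OF refl])
    fix B assume "B \<in> {..<m}"
    then have B: "B < m" by simp
    have idx: "2 * (2 * B) = 4 * B" "2 * (2 * B + 1) = 4 * B + 2"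
      "4 * B + 2 + 1 = 4 * B + 3" by simp_all
    show "?f (2 * B) + ?f (2 * B + 1) = (if B \<in> S
        then g (p (4 * B)) (p (4 * B + 2)) i + g (p (4 * B + 1)) (p (4 * B + 3)) i
        else g (p (4 * B)) (p (4 * B + 1)) i + g (p (4 * B + 2)) (p (4 * B + 3)) i)"
      unfolding idx swap_blocks_block[OF B] by simp
  qed
  also have "(\<Sum>j\<in>{2 * m..<n}. ?f j) = (\<Sum>j\<in>{2 * m..<n}. g (p (2 * j)) (p (2 * j + 1)) i)"
    by (intro sum.cong) (auto simp: swap_blocks_ge)
  finally show ?thesis .
qed

lemma swap_blocks_empty: "swap_blocks m {} = id"
  by (auto simp: swap_blocks_def)

lemma W_eq:
  "W p B i = (g (p (4 * B)) (p (4 * B + 1)) i + g (p (4 * B + 2)) (p (4 * B + 3)) i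
     - g (p (4 * B)) (p (4 * B + 2)) i - g (p (4 * B + 1)) (p (4 * B + 3)) i) / 2"
  by (simp add: half_def block_def)

lemma msum_swap:
  "msum (p \<circ> swap_blocks m S) i = centre p i + (\<Sum>B<m. (if B \<in> S then - 1 else 1) * W p B i)"
proof -
  have centre: "centre p i = (\<Sum>B<m. (g (p (4 * B)) (p (4 * B + 1)) i + g (p (4 * B + 2)) (p (4 * B + 3)) i
      + g (p (4 * B)) (p (4 * B + 2)) i + g (p (4 * B + 1)) (p (4 * B + 3)) i) / 2)
     + (\<Sum>j\<in>{2 * m..<n}. g (p (2 * j)) (p (2 * j + 1)) i)"
    using msum_split[of p "{}" i] msum_split[of p UNIV i]
    unfolding centre_def swap_blocks_empty comp_id
    by (simp add: sum.distrib[symmetric] sum_divide_distrib[symmetric] algebra_simps)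
  show ?thesis
    unfolding centre msum_split W_eq
    by (simp add: sum.distrib[symmetric] add.commute add.left_commute)
      (rule sum.cong, simp_all add: field_simps)
qed

lemma W_bound:
  assumes "p permutes {..<N}" "B < m"
  shows "l1_norm k (W p B) \<le> 10"
proof -
  have lt: "4 * B + 3 < N" using assms(2) m(1) by linarith
  have g: "l1_norm k (g (p a) (p b)) \<le> 5" if "a < N" "b < N" "a \<noteq> b" for a b
    using that permutes_in_image[OF assms(1)] permutes_inj[OF assms(1)]
    by (intro g_bound) (auto simp: inj_eq)
  have "l1_norm k (\<lambda>i. (g (p (4 * B)) (p (4 * B + 1)) i + g (p (4 * B + 2)) (p (4 * B + 3)) i)
     - (g (p (4 * B)) (p (4 * B + 2)) i + g (p (4 * B + 1)) (p (4 * B + 3)) i)) \<le> (5 + 5) + (5 + 5)"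
    using lt
    by (intro order_trans[OF l1_norm_diff] order_trans[OF l1_norm_add] add_mono g) auto
  moreover have "W p B = (\<lambda>i. (1/2) * ((g (p (4 * B)) (p (4 * B + 1)) i + g (p (4 * B + 2)) (p (4 * B + 3)) i)
     - (g (p (4 * B)) (p (4 * B + 2)) i + g (p (4 * B + 1)) (p (4 * B + 3)) i)))"
    unfolding W_eq[abs_def] by (simp add: fun_eq_iff)
  ultimately show ?thesis by (simp only: l1_norm_scale)
qed

lemma W_dot_bound:
  assumes "p permutes {..<N}" "B < m"
  shows "dot k (W p B) (W p B) \<le> 100"
proof -
  have "l1_norm k (W p B) ^ 2 \<le> 10 ^ 2"
    using W_bound[OF assms] by (intro power_mono) (auto simp: l1_norm_def intro!: sum_nonneg)
  then show ?thesis using dot_self_le_l1_norm[of k "W p B"] by simp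
qed

lemma zero_row_sums_dot: "zero_row_sums N (\<lambda>u v. dot k y (g u v))"
proof
  show "4 \<le> N" using n by simp
  show "dot k y (g u v) = dot k y (g v u)" for u v by (simp add: g_sym)
  show "(\<Sum>v\<in>{..<N} - {u}. dot k y (g u v)) = 0" if "u < N" for u
    using g_row[OF that] unfolding dot_sum_right[symmetric] by (simp add: dot_def)
qed

text \<open>Both matchings averaged in \<open>centre\<close> are uniformly distributed. The bound
  \<open>2 * n * var\<close> for one matching becomes \<open>6 * m * var\<close>, and
  \<open>half_swap_second_moment\<close> trades \<open>var\<close> for the second moment of a
  block.\<close>

lemma centre_second_moment:
  "perm_avg N (\<lambda>p. (dot k y (centre p))\<^sup>2) \<le> 6 * (real m * perm_avg N (\<lambda>p. (dot k y (W p 0))\<^sup>2))"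
proof -
  interpret zero_row_sums N "\<lambda>u v. dot k y (g u v)" by (rule zero_row_sums_dot)
  let ?q = "swap_blocks m UNIV"
  let ?M = "\<lambda>p. dot k y (msum p)"
  have msum: "?M p = (\<Sum>j<n. dot k y (g (p (2 * j)) (p (2 * j + 1))))" for p
    unfolding msum_def[abs_def] by (rule dot_sum_right)
  have centre: "dot k y (centre p) = (?M p + ?M (p \<circ> ?q)) / 2" for p
  proof -
    have "dot k y (centre p) = dot k y (\<lambda>i. (1/2) * (msum p i + msum (p \<circ> ?q) i))"
      by (simp add: centre_def[abs_def])
    then show ?thesis unfolding dot_scale_right dot_add_right by simp
  qed
  have "(dot k y (centre p))\<^sup>2 \<le> (1/2) * (?M p)\<^sup>2 + (1/2) * (?M (p \<circ> ?q))\<^sup>2" for p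
    unfolding centre using zero_le_power2[of "?M p - ?M (p \<circ> ?q)"]
    by (simp add: power_divide power2_sum power2_diff field_simps)
  then have "perm_avg N (\<lambda>p. (dot k y (centre p))\<^sup>2)
      \<le> perm_avg N (\<lambda>p. (1/2) * (?M p)\<^sup>2 + (1/2) * (?M (p \<circ> ?q))\<^sup>2)"
    by (intro perm_avg_mono) simp
  also have "\<dots> = perm_avg N (\<lambda>p. (?M p)\<^sup>2)"
    using perm_avg_compose[OF swap_blocks_permutes[OF m(1)], of "\<lambda>p. (?M p)\<^sup>2" UNIV]
    unfolding perm_avg_add perm_avg_cmult by simp
  also have "\<dots> \<le> 2 * real n * var"
    using matching_second_moment[OF refl] by (simp add: msum)
  also have "\<dots> \<le> 2 * (3 * real m) * var"
    using m(3) var_nonneg by (intro mult_right_mono mult_left_mono) auto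
  also have "var \<le> perm_avg N (\<lambda>p. (dot k y (W p 0))\<^sup>2)"
  proof -
    have "dot k y (W p 0) = (dot k y (g (p 0) (p 1)) + dot k y (g (p 2) (p 3))
        - dot k y (g (p 0) (p 2)) - dot k y (g (p 1) (p 3))) / 2" for p :: "nat \<Rightarrow> nat"
      unfolding W_eq[abs_def] dot_def
      by (simp add: sum.distrib[symmetric] sum_subtractf[symmetric] sum_divide_distrib algebra_simps numeral_2_eq_2)
    then show ?thesis using half_swap_second_moment by (simp only:)
  qed
  finally show ?thesis by (simp add: mult_left_mono)
qed

text \<open>The factor 6400 makes \<open>form_deviation_avg\<close> hold and keeps the coefficients of the blocks in \<open>[-1, 1]\<close>.\<close>

definition \<rho> :: real where
  "\<rho> = 6400 * real k"

lemma rho_pos: "0 < \<rho>"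
  using k by (simp add: \<rho>_def)

text \<open>The expectation of \<open>sample_form p\<close>, since every block is distributed like
  block 0. The term with \<open>\<rho>\<close> makes the form definite.\<close>

definition mean_form :: "(nat \<Rightarrow> real) \<Rightarrow> (nat \<Rightarrow> real) \<Rightarrow> real" where
  "mean_form x y = real m * perm_avg N (\<lambda>p. dot k x (W p 0) * dot k y (W p 0)) + \<rho> * dot k x y"

definition sample_form :: "(nat \<Rightarrow> nat) \<Rightarrow> (nat \<Rightarrow> real) \<Rightarrow> (nat \<Rightarrow> real) \<Rightarrow> real" where
  "sample_form p x y = (\<Sum>B<m. dot k x (W p B) * dot k y (W p B)) + \<rho> * dot k x y"

lemma mean_form_ge: "\<rho> * dot k x x \<le> mean_form x x"
  by (simp add: mean_form_def perm_avg_nonneg)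

lemma sample_form_ge: "\<rho> * dot k x x \<le> sample_form p x x"
  by (simp add: sample_form_def sum_nonneg)

lemma positive_formI:
  assumes "\<And>x y z c. b (\<lambda>i. x i + c * y i) z = b x z + c * b y z"
    and "\<And>x y. b x y = b y x" and ge: "\<And>x. \<rho> * dot k x x \<le> b x x"
  shows "positive_form k b"
proof
  show "0 \<le> b x x" for x
    using ge[of x] dot_self_nonneg[of k x] rho_pos
    by (metis mult_nonneg_nonneg less_imp_le order_trans)
  show "x = (\<lambda>_. 0)" if "\<forall>i\<ge>k. x i = 0" "b x x = 0" for x
  proof
    have "\<rho> * dot k x x \<le> 0" using ge[of x] that by simp
    then have "dot k x x = 0"
      using rho_pos dot_self_nonneg[of k x] by (simp add: mult_le_0_iff)
    then show "x i = 0" for i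
      using that(1) dot_self_eq_0 by (cases "i < k") auto
  qed
qed (rule assms)+

lemma mean_form_positive: "positive_form k mean_form"
  by (rule positive_formI[of mean_form, OF _ _ mean_form_ge])
    (simp_all add: mean_form_def dot_add_scaled_left distrib_right perm_avg_add mult.assoc
      perm_avg_cmult dot_commute algebra_simps)

lemma sample_form_positive: "positive_form k (sample_form p)"
  by (rule positive_formI[of "sample_form p", OF _ _ sample_form_ge])
    (simp_all add: sample_form_def dot_add_scaled_left sum.distrib sum_distrib_left
      dot_commute algebra_simps)

interpretation mean: positive_form k mean_form
  by (rule mean_form_positive)

lemma basis_form_le: "j < k \<Longrightarrow> real m * perm_avg N (\<lambda>p. (dot k (mean.basis j) (W p 0))\<^sup>2) \<le> 1"
proof -
  assume "j < k"
  then have "mean_form (mean.basis j) (mean.basis j) \<le> 1" by (rule mean.basis_norm_le_1)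
  moreover have "0 \<le> \<rho> * dot k (mean.basis j) (mean.basis j)"
    using rho_pos dot_self_nonneg by (simp add: less_imp_le)
  ultimately show ?thesis by (simp add: mean_form_def power2_eq_square)
qed

text \<open>The squared norm of \<open>centre p\<close> in the norm dual to
  \<open>mean_form\<close>.\<close>

definition centre_size :: "(nat \<Rightarrow> nat) \<Rightarrow> real" where
  "centre_size p = (\<Sum>j<k. (dot k (mean.basis j) (centre p))\<^sup>2)"

text \<open>The squared Frobenius norm to which \<open>perturbation\<close> applies.\<close>

definition form_deviation :: "(nat \<Rightarrow> nat) \<Rightarrow> real" where
  "form_deviation p = (\<Sum>i<k. \<Sum>j<k.
     (sample_form p (mean.basis i) (mean.basis j) - mean_form (mean.basis i) (mean.basis j))\<^sup>2)"

lemma centre_size_avg: "perm_avg N centre_size \<le> 6 * real k"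
proof -
  have "perm_avg N centre_size = (\<Sum>j<k. perm_avg N (\<lambda>p. (dot k (mean.basis j) (centre p))\<^sup>2))"
    by (simp add: centre_size_def[abs_def] perm_avg_sum)
  also have "\<dots> \<le> (\<Sum>j<k. 6)"
    using basis_form_le by (intro sum_mono order_trans[OF centre_second_moment]) auto
  finally show ?thesis by simp
qed

text \<open>The entrywise variance bounds add up to \<open>8 * m\<close> times the average of
  \<open>?S p * ?S p\<close>. One factor is at most \<open>100 / \<rho>\<close> by
  \<open>basis_bessel\<close>; the other, multiplied by \<open>m\<close>, averages to at most
  \<open>k\<close>. The total is \<open>800 * k / \<rho> = 1/8\<close>.\<close>

lemma form_deviation_avg: "perm_avg N form_deviation \<le> 1/8"
proof -
  let ?e = mean.basis
  let ?S = "\<lambda>p. \<Sum>j<k. (dot k (?e j) (W p 0))\<^sup>2"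
  have "perm_avg N form_deviation = (\<Sum>i<k. \<Sum>j<k. perm_avg N (\<lambda>p.
     (sample_form p (?e i) (?e j) - mean_form (?e i) (?e j))\<^sup>2))"
    by (simp add: form_deviation_def[abs_def] perm_avg_sum)
  also have "\<dots> \<le> (\<Sum>i<k. \<Sum>j<k. 8 * real m * perm_avg N (\<lambda>p.
     (dot k (?e i) (W p 0))\<^sup>2 * (dot k (?e j) (W p 0))\<^sup>2))"
  proof (intro sum_mono)
    fix i j
    show "perm_avg N (\<lambda>p. (sample_form p (?e i) (?e j) - mean_form (?e i) (?e j))\<^sup>2)
      \<le> 8 * real m * perm_avg N (\<lambda>p. (dot k (?e i) (W p 0))\<^sup>2 * (dot k (?e j) (W p 0))\<^sup>2)"
      using block_sum_variance[of N m "\<lambda>t. dot k (?e i) (half t) * dot k (?e j) (half t)"] n m(1)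
      by (simp add: sample_form_def mean_form_def power_mult_distrib)
  qed
  also have "\<dots> = 8 * real m * perm_avg N (\<lambda>p. ?S p * ?S p)"
    unfolding sum_product unfolding perm_avg_sum sum_distrib_left ..
  also have "\<dots> \<le> 8 * real m * perm_avg N (\<lambda>p. (100 / \<rho>) * ?S p)"
  proof (intro mult_left_mono perm_avg_mono mult_right_mono)
    fix p assume p: "p permutes {..<N}"
    have "\<rho> * ?S p \<le> 100"
      using mean.basis_bessel[OF mean_form_ge rho_pos, of "W p 0"] W_dot_bound[OF p m(2)]
      by simp
    then show "?S p \<le> 100 / \<rho>" using rho_pos by (simp add: field_simps)
  qed (auto intro: sum_nonneg)
  also have "\<dots> = (800 / \<rho>) * (\<Sum>j<k. real m * perm_avg N (\<lambda>p. (dot k (?e j) (W p 0))\<^sup>2))"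
    unfolding perm_avg_cmult perm_avg_sum by (simp add: sum_distrib_left)
  also have "\<dots> \<le> (800 / \<rho>) * (\<Sum>j<k. 1)"
    using basis_form_le rho_pos by (intro mult_left_mono sum_mono) auto
  also have "\<dots> = 1/8" using k by (simp add: \<rho>_def)
  finally show ?thesis .
qed

lemma good_permutation:
  obtains p where "p permutes {..<N}" "centre_size p \<le> 12 * real k" "form_deviation p \<le> 1/4"
proof -
  \<comment> \<open>The weights make each nonnegative term average at most 1/2, so some permutation
    keeps the sum, and hence both terms, at most 1.\<close>
  have "perm_avg N (\<lambda>p. (1 / (12 * real k)) * centre_size p + 4 * form_deviation p)
      = (1 / (12 * real k)) * perm_avg N centre_size + 4 * perm_avg N form_deviation"
    by (simp only: perm_avg_add perm_avg_cmult)
  also have "\<dots> \<le> (1 / (12 * real k)) * (6 * real k) + 4 * (1/8)"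
    using centre_size_avg form_deviation_avg by (intro add_mono mult_left_mono) auto
  also have "\<dots> = 1" using k by simp
  finally obtain p where p: "p permutes {..<N}"
    "(1 / (12 * real k)) * centre_size p + 4 * form_deviation p \<le> 1"
    by (rule perm_avg_ge_min)
  have "0 \<le> centre_size p" "0 \<le> form_deviation p"
    by (simp_all add: centre_size_def form_deviation_def sum_nonneg)
  then have "0 \<le> (1 / (12 * real k)) * centre_size p" "0 \<le> 4 * form_deviation p"
    by simp_all
  then have "(1 / (12 * real k)) * centre_size p \<le> 1" "4 * form_deviation p \<le> 1"
    using p(2) by linarith+
  then show ?thesis using that[OF p(1)] k by (simp add: field_simps)
qed

lemma balanced_permutation:
  obtains p where "p permutes {..<N}" "l1_norm k (msum p) \<le> 575 * (real k)\<^sup>2"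
proof -
  obtain p where p: "p permutes {..<N}"
    and X: "centre_size p \<le> 12 * real k" and Y: "form_deviation p \<le> 1/4"
    by (rule good_permutation)
  interpret sample: positive_form k "sample_form p" by (rule sample_form_positive)
  \<comment> \<open>Tested coordinatewise, this says that \<open>\<rho>\<close> times
    \<open>z\<close> plus the sum of \<open>dot k z (W p B)\<close> times \<open>W p B\<close>
    equals \<open>centre p\<close>.\<close>
  obtain z where z: "\<forall>i\<ge>k. z i = 0"
    and riesz: "\<And>y. \<forall>i\<ge>k. y i = 0 \<Longrightarrow> sample_form p z y = dot k y (centre p)"
    using sample.riesz[of "centre p"] by blast
  have "(sample_form p z z)\<^sup>2 \<le> mean_form z z * centre_size p"
  proof -
    have "sample_form p z z = dot k (\<lambda>j. mean_form z (mean.basis j)) (\<lambda>j. dot k (mean.basis j) (centre p))"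
      unfolding riesz[OF z] mean.dot_expansion[OF z] by (simp add: dot_def)
    then show ?thesis
      using dot_cauchy_schwarz[of k "\<lambda>j. mean_form z (mean.basis j)" "\<lambda>j. dot k (mean.basis j) (centre p)"]
      by (simp add: centre_size_def mean.parseval[OF z] dot_def power2_eq_square)
  qed
  also have "\<dots> \<le> mean_form z z * (12 * real k)"
    using X mean.nonneg by (rule mult_left_mono)
  finally have upper: "(sample_form p z z)\<^sup>2 \<le> mean_form z z * (12 * real k)" .
  \<comment> \<open>Writing \<open>A\<close> for the mean and \<open>s\<close> for the sampled value
    at \<open>z\<close>, the bounds \<open>A \<le> 2 * s\<close> and
    \<open>s * s \<le> 12 * k * A\<close> force \<open>A \<le> 48 * k\<close>.\<close>
  have "mean_form z z \<le> 2 * sample_form p z z"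
    using Y by (intro mean.perturbation[OF sample_form_positive _ z]) (simp add: form_deviation_def)
  then have "(mean_form z z)\<^sup>2 \<le> (2 * sample_form p z z)\<^sup>2"
    using mean.nonneg by (rule power_mono)
  also have "\<dots> \<le> mean_form z z * (48 * real k)"
    using upper by (simp add: power_mult_distrib mult.commute mult.left_commute)
  finally have "mean_form z z \<le> 48 * real k"
    using mean.nonneg[of z] by (cases "mean_form z z = 0") (auto simp: power2_eq_square)
  then have zz: "\<rho> * dot k z z \<le> 48 * real k"
    using mean_form_ge[of z] by linarith
  define x where "x = (\<lambda>B. - dot k z (W p B))"
  \<comment> \<open>Here \<open>100 * dot k z z \<le> 100 * 48 / 6400 = 3/4\<close>.\<close>
  have x: "\<forall>B\<in>{..<m}. \<bar>x B\<bar> \<le> 1"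
  proof
    fix B assume "B \<in> {..<m}"
    then have "(x B)\<^sup>2 \<le> dot k z z * 100"
      unfolding x_def power2_minus
      using W_dot_bound[OF p] dot_self_nonneg[of k z]
      by (intro order_trans[OF dot_cauchy_schwarz] mult_left_mono) auto
    also have "\<dots> \<le> 1" using zz k by (simp add: \<rho>_def)
    finally show "\<bar>x B\<bar> \<le> 1" by (simp add: abs_square_le_1)
  qed
  have residual: "centre p i + (\<Sum>B<m. x B * W p B i) = \<rho> * z i" if "i < k" for i
  proof -
    define e where "e = (\<lambda>j. if j = i then 1 else 0 :: real)"
    have dot_e: "dot k e y = y i" for y
      using that by (simp add: dot_def e_def if_distrib[of "\<lambda>a. a * _"] cong: if_cong)
    have "sample_form p z e = centre p i"
      using riesz[of e] that by (simp add: e_def dot_e[unfolded e_def])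
    then show ?thesis
      by (simp add: sample_form_def dot_e dot_commute[of k z e] x_def sum_negf)
  qed
  have "(l1_norm k (\<lambda>i. \<rho> * z i))\<^sup>2 \<le> real k * (\<rho>\<^sup>2 * dot k z z)"
    using l1_norm_le_dot_self[of k "\<lambda>i. \<rho> * z i"]
    by (simp add: dot_def sum_distrib_left power2_eq_square ac_simps)
  also have "\<dots> = real k * \<rho> * (\<rho> * dot k z z)" by (simp add: power2_eq_square)
  also have "\<dots> \<le> real k * \<rho> * (48 * real k)"
    using zz rho_pos by (intro mult_left_mono) auto
  \<comment> \<open>The constant comes from \<open>6400 * 48 = 307200\<close>, just below the square
    308025 of 555.\<close>
  also have "\<dots> \<le> (555 * (real k)\<^sup>2)\<^sup>2"
  proof -
    have "real k ^ 3 \<le> real k ^ 4" using k by (intro power_increasing) auto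
    then have "307200 * real k ^ 3 \<le> 308025 * real k ^ 4" by (intro mult_mono) auto
    moreover have "real k * \<rho> * (48 * real k) = 307200 * real k ^ 3"
      by (simp add: \<rho>_def power3_eq_cube)
    moreover have "(555 * (real k)\<^sup>2)\<^sup>2 = 308025 * real k ^ 4"
      by (simp add: power_mult_distrib)
    ultimately show ?thesis by simp
  qed
  finally have l1_residual: "l1_norm k (\<lambda>i. \<rho> * z i) \<le> 555 * (real k)\<^sup>2"
    by (rule power2_le_imp_le) simp
  obtain s where s: "\<And>B. \<bar>s B\<bar> = (1::real)"
    and round: "l1_norm k (\<lambda>i. (\<Sum>B<m. s B * W p B i) - (\<Sum>B<m. x B * W p B i)) \<le> 2 * 10 * real k"
    by (rule round_to_signs[OF finite_lessThan x, of k "W p" 10]) (use W_bound[OF p] in auto)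
  \<comment> \<open>The blocks to be swapped are those with negative sign.\<close>
  define S where "S = {B. s B = -1}"
  have s_eq: "(if B \<in> S then - 1 else 1) = s B" for B
    using s[of B] by (auto simp: S_def abs_if split: if_splits)
  define q where "q = p \<circ> swap_blocks m S"
  have "l1_norm k (msum q) = l1_norm k (\<lambda>i. \<rho> * z i
      + ((\<Sum>B<m. s B * W p B i) - (\<Sum>B<m. x B * W p B i)))"
    unfolding l1_norm_def q_def msum_swap s_eq
    by (rule sum.cong) (simp_all add: residual[symmetric])
  also have "\<dots> \<le> 555 * (real k)\<^sup>2 + 20 * real k"
    using round by (intro order_trans[OF l1_norm_add] add_mono l1_residual) simp
  also have "\<dots> \<le> 575 * (real k)\<^sup>2"
    using k by (simp add: power2_eq_square)
  finally have "l1_norm k (msum q) \<le> 575 * (real k)\<^sup>2" .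
  moreover have "q permutes {..<N}"
    unfolding q_def by (rule permutes_compose[OF swap_blocks_permutes[OF m(1)] p])
  ultimately show ?thesis by (rule that[rotated])
qed

end

section \<open>From edge vectors to matchings\<close>

definition pairing :: "nat \<Rightarrow> (nat \<Rightarrow> nat) \<Rightarrow> nat sgraph" where
  "pairing n p = \<lparr>sverts = {..<2 * n}, sedges = (\<lambda>j. {p (2 * j), p (2 * j + 1)}) ` {..<n}\<rparr>"

lemma pairing_inj:
  fixes p :: "nat \<Rightarrow> nat"
  assumes "p permutes {..<2 * n}"
  shows "inj_on (\<lambda>j. {p (2 * j), p (2 * j + 1)}) {..<n}"
proof (rule inj_onI)
  fix i j assume "{p (2 * i), p (2 * i + 1)} = {p (2 * j), p (2 * j + 1)}"
  then have "p (2 * i) = p (2 * j) \<or> p (2 * i) = p (2 * j + 1)" by blast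
  then have "2 * i = 2 * j \<or> 2 * i = 2 * j + 1"
    using permutes_inj[OF assms] by (auto simp: inj_eq)
  then show "i = j" by presburger
qed

lemma pairing_perfect_matching:
  assumes p: "p permutes {..<2 * n}"
  shows "is_perfect_matching (pairing n p) (complete_sgraph {..<2 * n})"
proof -
  have inj: "p x = p y \<longleftrightarrow> x = y" for x y
    using permutes_inj[OF p] by (rule inj_eq)
  have in_V: "p x < 2 * n" if "x < 2 * n" for x
    using permutes_in_image[OF p, of x] that by simp
  have edge: "{p (2 * j), p (2 * j + 1)} \<subseteq> {..<2 * n}" "card {p (2 * j), p (2 * j + 1)} = 2"
    if "j < n" for j
    using that in_V[of "2 * j"] in_V[of "2 * j + 1"] by (auto simp: inj)
  have "\<exists>!e. e \<in> sedges (pairing n p) \<and> v \<in> e" if v: "v < 2 * n" for v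
  proof -
    have "v \<in> p ` {..<2 * n}" using permutes_image[OF p] v by simp
    then obtain x where x: "x < 2 * n" "v = p x" by auto
    define j where "j = x div 2"
    have j: "j < n" "x = 2 * j \<or> x = 2 * j + 1" using x(1) unfolding j_def by presburger+
    show ?thesis
    proof (rule ex1I[of _ "{p (2 * j), p (2 * j + 1)}"])
      show "{p (2 * j), p (2 * j + 1)} \<in> sedges (pairing n p) \<and> v \<in> {p (2 * j), p (2 * j + 1)}"
        using j x by (auto simp: pairing_def)
      fix e assume "e \<in> sedges (pairing n p) \<and> v \<in> e"
      then obtain i where i: "i < n" "e = {p (2 * i), p (2 * i + 1)}" "v \<in> e"
        by (auto simp: pairing_def)
      then have "x = 2 * i \<or> x = 2 * i + 1" using x inj by auto
      with j have "i = j" by presburger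
      with i show "e = {p (2 * j), p (2 * j + 1)}" by simp
    qed
  qed
  then show ?thesis
    using edge by (auto simp: is_perfect_matching_def is_subgraph_def complete_sgraph_def pairing_def)
qed

lemma num_edges_pairing: "p permutes {..<2 * n} \<Longrightarrow> num_edges (pairing n p) = n"
  using card_image[OF pairing_inj] by (simp add: num_edges_def pairing_def)

lemma graph_sum_pairing:
  "p permutes {..<2 * n} \<Longrightarrow>
     graph_sum h (pairing n p) i = (\<Sum>j<n. h {p (2 * j), p (2 * j + 1)} i)"
  using sum.reindex[OF pairing_inj, of p n "\<lambda>e. h e i"] by (simp add: graph_sum_def pairing_def)

lemma finite_complete_edges: "finite V \<Longrightarrow> finite (sedges (complete_sgraph V))"
  by (simp add: complete_sgraph_def)

lemma num_edges_complete: "real (num_edges (complete_sgraph {..<2 * n})) = real n * (2 * real n - 1)"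
proof -
  have "num_edges (complete_sgraph {..<2 * n}) = (2 * n) choose 2"
    unfolding num_edges_def complete_sgraph_def using n_subsets[of "{..<2 * n}" 2] by simp
  also have "\<dots> = n * (2 * n - 1)" by (simp add: choose_two)
  finally show ?thesis by (cases n) (simp_all add: algebra_simps)
qed

text \<open>Double counting: every edge is seen from both of its ends.\<close>

lemma degree_sum:
  fixes h :: "nat set \<Rightarrow> nat \<Rightarrow> real"
  assumes "finite V"
  shows "(\<Sum>u\<in>V. \<Sum>v\<in>V - {u}. h {u, v} i) = 2 * graph_sum h (complete_sgraph V) i"
proof -
  let ?E = "sedges (complete_sgraph V)"
  have E: "finite ?E" using assms by (rule finite_complete_edges)
  have "(\<Sum>v\<in>V - {u}. h {u, v} i) = (\<Sum>e\<in>{e\<in>?E. u \<in> e}. h e i)" if u: "u \<in> V" for u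
  proof (rule sum.reindex_bij_betw)
    show "bij_betw (\<lambda>v. {u, v}) (V - {u}) {e\<in>?E. u \<in> e}"
    proof (rule bij_betwI')
      fix e assume "e \<in> {e\<in>?E. u \<in> e}"
      then show "\<exists>v\<in>V - {u}. e = {u, v}"
        by (auto simp: complete_sgraph_def card_2_iff insert_commute doubleton_eq_iff)
    qed (use u in \<open>auto simp: complete_sgraph_def doubleton_eq_iff\<close>)
  qed
  then have "(\<Sum>u\<in>V. \<Sum>v\<in>V - {u}. h {u, v} i) = (\<Sum>u\<in>V. \<Sum>e\<in>{e\<in>?E. u \<in> e}. h e i)"
    by simp
  also have "\<dots> = (\<Sum>e\<in>?E. \<Sum>u\<in>{u\<in>V. u \<in> e}. h e i)"
    by (rule sum.swap_restrict[OF assms E])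
  also have "\<dots> = (\<Sum>e\<in>?E. 2 * h e i)"
  proof (rule sum.cong[OF refl])
    fix e assume "e \<in> ?E"
    then have "{u\<in>V. u \<in> e} = e" "card e = 2" by (auto simp: complete_sgraph_def)
    then show "(\<Sum>u\<in>{u\<in>V. u \<in> e}. h e i) = 2 * h e i" by simp
  qed
  also have "\<dots> = 2 * graph_sum h (complete_sgraph V) i"
    by (simp add: graph_sum_def sum_distrib_left)
  finally show ?thesis .
qed

lemma l1_norm_sum_le:
  assumes "\<And>j. j \<in> J \<Longrightarrow> l1_norm k (f j) \<le> 1"
  shows "l1_norm k (\<lambda>i. \<Sum>j\<in>J. f j i) \<le> real (card J)"
  using order_trans[OF l1_norm_sum sum_mono[of J "\<lambda>j. l1_norm k (f j)" "\<lambda>_. 1"]] assms by simp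

text \<open>A perfect matching has \<open>n\<close> of the \<open>n * (2 * n - 1)\<close>
  edges.\<close>

lemma graph_disc_pairing:
  assumes "p permutes {..<2 * n}" "n > 0"
  shows "graph_disc k h (complete_sgraph {..<2 * n}) (pairing n p) =
    l1_norm k (\<lambda>i. (\<Sum>j<n. h {p (2 * j), p (2 * j + 1)} i)
      - graph_sum h (complete_sgraph {..<2 * n}) i / (2 * real n - 1))"
  using assms
  by (simp add: graph_disc_def graph_sum_pairing num_edges_pairing num_edges_complete)

section \<open>Reduction to zero row sums by vertex potentials\<close>

locale bounded_edge_vectors =
  fixes n k :: nat and h :: "nat set \<Rightarrow> nat \<Rightarrow> real"
  assumes n_pos: "0 < n" and k_pos: "0 < k"
    and h_bound: "e \<in> sedges (complete_sgraph {..<2 * n}) \<Longrightarrow> l1_norm k (h e) \<le> 1"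
begin

abbreviation "K \<equiv> complete_sgraph {..<2 * n}"

lemma h_pair_bound: "\<lbrakk>u < 2 * n; v < 2 * n; u \<noteq> v\<rbrakk> \<Longrightarrow> l1_norm k (h {u, v}) \<le> 1"
  by (intro h_bound) (auto simp: complete_sgraph_def)

lemma mean_bound: "l1_norm k (\<lambda>i. graph_sum h K i / (2 * real n - 1)) \<le> real n"
proof -
  have "l1_norm k (graph_sum h K) \<le> real (num_edges K)"
    unfolding num_edges_def graph_sum_def by (rule l1_norm_sum_le[OF h_bound])
  then have "1 / (2 * real n - 1) * l1_norm k (graph_sum h K) \<le> 1 / (2 * real n - 1) * (real n * (2 * real n - 1))"
    unfolding num_edges_complete using n_pos by (intro mult_left_mono) auto
  then show ?thesis
    using l1_norm_scale[of k "1 / (2 * real n - 1)" "graph_sum h K"] n_pos by simp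
qed

text \<open>Settles the case \<open>n < 32\<close>, where the random argument is not
  applied.\<close>

lemma graph_disc_trivial: "graph_disc k h K (pairing n id) \<le> 2 * real n"
proof -
  have "l1_norm k (\<lambda>i. \<Sum>j<n. h {2 * j, 2 * j + 1} i) \<le> real (card {..<n})"
    by (rule l1_norm_sum_le[OF h_pair_bound]) auto
  then have "l1_norm k (\<lambda>i. \<Sum>j<n. h {2 * j, 2 * j + 1} i) + l1_norm k (\<lambda>i. graph_sum h K i / (2 * real n - 1))
      \<le> 2 * real n"
    using mean_bound by simp
  then show ?thesis
    unfolding graph_disc_pairing[OF permutes_id n_pos] id_apply
    by (rule order_trans[OF l1_norm_diff])
qed

text \<open>Chosen so that \<open>h {u, v} - potential u - potential v\<close> has zero row sums.\<close>

definition potential :: "nat \<Rightarrow> nat \<Rightarrow> real" where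
  "potential u i = (1 / (2 * real n - 2)) *
     ((\<Sum>v\<in>{..<2 * n} - {u}. h {u, v} i) - graph_sum h K i / (2 * real n - 1))"

definition reduced :: "nat \<Rightarrow> nat \<Rightarrow> nat \<Rightarrow> real" where
  "reduced u v i = h {u, v} i - (potential u i + potential v i)"

lemma potential_sum:
  assumes "n > 1"
  shows "(\<Sum>u<2 * n. potential u i) = graph_sum h K i / (2 * real n - 1)"
proof -
  have "(\<Sum>u<2 * n. potential u i) = (1 / (2 * real n - 2)) *
      (2 * graph_sum h K i - 2 * real n * (graph_sum h K i / (2 * real n - 1)))"
    using degree_sum[of "{..<2 * n}" h i]
    by (simp only: potential_def sum_distrib_left[symmetric] sum_subtractf) simp
  also have "\<dots> = graph_sum h K i / (2 * real n - 1)"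
    using assms by (simp add: divide_simps) (simp add: algebra_simps)
  finally show ?thesis .
qed

lemma reduced_row:
  assumes "n > 1" "u < 2 * n"
  shows "(\<Sum>v\<in>{..<2 * n} - {u}. reduced u v i) = 0"
proof -
  let ?r = "\<Sum>v\<in>{..<2 * n} - {u}. h {u, v} i"
  have "(\<Sum>v\<in>{..<2 * n} - {u}. potential v i) = graph_sum h K i / (2 * real n - 1) - potential u i"
    using potential_sum[OF assms(1), of i] sum.remove[of "{..<2 * n}" u "\<lambda>v. potential v i"] assms(2)
    by simp
  then have "(\<Sum>v\<in>{..<2 * n} - {u}. reduced u v i)
      = ?r - ((2 * real n - 1) * potential u i + (graph_sum h K i / (2 * real n - 1) - potential u i))"
    using assms by (simp add: reduced_def sum_subtractf sum.distrib of_nat_diff)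
  also have "\<dots> = ?r - (2 * real n - 2) * potential u i - graph_sum h K i / (2 * real n - 1)"
    by (simp add: algebra_simps)
  also have "\<dots> = 0"
    using assms(1) by (simp add: potential_def)
  finally show ?thesis .
qed

text \<open>The norm is at most \<open>(3 * n - 1) / (2 * n - 2)\<close>, which is at most 2 exactly
  from \<open>n = 3\<close> on.\<close>

lemma potential_bound:
  assumes "n \<ge> 3" "u < 2 * n"
  shows "l1_norm k (potential u) \<le> 2"
proof -
  let ?r = "\<lambda>i. \<Sum>v\<in>{..<2 * n} - {u}. h {u, v} i"
  have "l1_norm k ?r \<le> real (card ({..<2 * n} - {u}))"
    using assms(2) by (intro l1_norm_sum_le h_pair_bound) auto
  then have "l1_norm k (\<lambda>i. ?r i - graph_sum h K i / (2 * real n - 1)) \<le> (2 * real n - 1) + real n"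
    using mean_bound assms
    by (intro order_trans[OF l1_norm_diff] add_mono) (auto simp: of_nat_diff)
  then have "(1 / (2 * real n - 2)) * l1_norm k (\<lambda>i. ?r i - graph_sum h K i / (2 * real n - 1))
      \<le> (1 / (2 * real n - 2)) * ((2 * real n - 1) + real n)"
    using assms(1) by (intro mult_left_mono) auto
  also have "\<dots> \<le> 2" using assms(1) by (simp add: field_simps)
  finally show ?thesis
    unfolding potential_def[abs_def] l1_norm_scale using assms(1) by simp
qed

lemma reduced_bound:
  assumes "n \<ge> 3" "u < 2 * n" "v < 2 * n" "u \<noteq> v"
  shows "l1_norm k (reduced u v) \<le> 5"
proof -
  have "l1_norm k (\<lambda>i. h {u, v} i - (potential u i + potential v i)) \<le> 1 + (2 + 2)"
    using assms
    by (intro order_trans[OF l1_norm_diff] add_mono order_trans[OF l1_norm_add]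
        h_pair_bound potential_bound)
  then show ?thesis by (simp add: reduced_def[abs_def])
qed

text \<open>A perfect matching covers every vertex once, so the subtracted potentials add up to
  their total, which is the mean term of the discrepancy.\<close>

lemma matching_sum_reduced:
  assumes "n > 1" "p permutes {..<2 * n}"
  shows "(\<Sum>j<n. reduced (p (2 * j)) (p (2 * j + 1)) i)
    = (\<Sum>j<n. h {p (2 * j), p (2 * j + 1)} i) - graph_sum h K i / (2 * real n - 1)"
proof -
  have "(\<Sum>j<n. potential (p (2 * j)) i + potential (p (2 * j + 1)) i) = (\<Sum>x<2 * n. potential (p x) i)"
    by (rule sum_lessThan_double[symmetric])
  also have "\<dots> = (\<Sum>u<2 * n. potential u i)"
    using sum.permute[OF assms(2), of "\<lambda>u. potential u i"] by (simp add: o_def)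
  finally show ?thesis
    by (simp add: reduced_def sum_subtractf potential_sum[OF assms(1)])
qed

lemma balanced_matching:
  "\<exists>M. is_perfect_matching M K \<and> graph_disc k h K M \<le> 575 * (real k)\<^sup>2"
proof (cases "n \<ge> 32")
  case True
  interpret zero_sum_vectors n k reduced
    using True k_pos reduced_row reduced_bound
    by unfold_locales (auto simp: reduced_def insert_commute add.commute)
  obtain p where p: "p permutes {..<2 * n}" "l1_norm k (msum p) \<le> 575 * (real k)\<^sup>2"
    by (rule balanced_permutation)
  have "msum p = (\<lambda>i. (\<Sum>j<n. h {p (2 * j), p (2 * j + 1)} i) - graph_sum h K i / (2 * real n - 1))"
    using True by (intro ext, unfold msum_def, intro matching_sum_reduced[OF _ p(1)]) simp
  then have "graph_disc k h K (pairing n p) \<le> 575 * (real k)\<^sup>2"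
    using p(2) by (simp only: graph_disc_pairing[OF p(1) n_pos])
  then show ?thesis using pairing_perfect_matching[OF p(1)] by blast
next
  case False
  have "1 * 1 \<le> real k * real k" using k_pos by (intro mult_mono) auto
  then have "2 * real n \<le> 575 * (real k)\<^sup>2"
    using False by (simp add: power2_eq_square)
  then show ?thesis
    using graph_disc_trivial pairing_perfect_matching[OF permutes_id] by (meson order_trans)
qed

end

theorem theorem1p3:
  shows "\<exists>C::real. C > 0 \<and>
    (\<forall>(n::nat) (k::nat) (h :: nat set \<Rightarrow> nat \<Rightarrow> real).
       n > 0 \<longrightarrow> k > 0 \<longrightarrow>
       (\<forall>e\<in>sedges (complete_sgraph {..<2 * n}). l1_norm k (h e) \<le> 1) \<longrightarrow>
       (\<exists>M. is_perfect_matching M (complete_sgraph {..<2 * n}) \<and>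
            graph_disc k h (complete_sgraph {..<2 * n}) M \<le> C * real k ^ 2))"
proof (intro exI[of _ 575] conjI allI impI)
  fix n k :: nat and h :: "nat set \<Rightarrow> nat \<Rightarrow> real"
  assume "n > 0" "k > 0" "\<forall>e\<in>sedges (complete_sgraph {..<2 * n}). l1_norm k (h e) \<le> 1"
  then interpret bounded_edge_vectors n k h
    by unfold_locales auto
  show "\<exists>M. is_perfect_matching M (complete_sgraph {..<2 * n}) \<and>
      graph_disc k h (complete_sgraph {..<2 * n}) M \<le> 575 * real k ^ 2"
    by (rule balanced_matching)
qed simp

end
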